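(* Let $f\in L^2(\Omega;\mathbb V)$. Suppose $A$ satisfies the isotropy assumption (see context) with $Q(x)=Q_0$ for all $x\in\Omega$. Let $U_h=\Sigma_h\times W_h\times M_h\times F_h\subseteq U$ be a finite dimensional subspace, where $\Sigma_h\subseteq L^2(\Omega;\mathbb M)$, $W_h\subseteq L^2(\Omega;\mathbb V)$, $M_h\subseteq H_0^{1/2}(\partial\Omega_h;\mathbb V)$, $F_h\subseteq H^{-1/2}(\partial\Omega_h;\mathbb V)$ are subspaces such that $I\in\Sigma_h$ and $In|_{\partial\Omega_h}\in F_h$. Then $(\sigma_h,u_h,\hat u_h,\hat\sigma_{n,h})\in U_h$ solves the first DPG method $$b\big((\sigma_h,u_h,\hat u_h,\hat\sigma_{n,h}),(\tau,v,q)\big)=(f,v)_\Omega\qquad\forall(\tau,v,q)\in T(U_h)$$ if and only if $(\sigma_h,u_h,\hat u_h,\hat\sigma_{n,h},0)\in U_h\times\mathbb R$ is the solution of the second DPG method $$b^{(2)}\big((\sigma_h,u_h,\hat u_h,\hat\sigma_{n,h},0),(\tau,v,q,\beta)\big)=(f,v)_\Omega\qquad\forall(\tau,v,q,\beta)\in T^{(2)}(U_h\times\mathbb R).$$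
   Context: Setting. $N\in\{2,3\}$; $\Omega\subset\mathbb R^N$ is a bounded open set with connected Lipschitz boundary. $\mathbb M$ is the space of real $N\times N$ matrices (Frobenius inner product), $\mathbb S$ and $\mathbb K$ its subspaces of symmetric and skew-symmetric matrices, $\mathbb V=\mathbb R^N$, $I\in\mathbb M$ the identity. The divergence of a matrix function is taken row-wise; $\nabla v$ is matrix valued for $v$ vector valued. The compliance tensor $A(x)$ is, for a.e. $x\in\Omega$, a linear map $\mathbb M\to\mathbb M$, self-adjoint and positive definite uniformly on $\Omega$, with components in $L^\infty(\Omega)$. Set $Q_0=\operatorname{ess\,inf}_{x\in\Omega}N^{-1}\operatorname{tr}(A(x)I)$. Isotropy assumption. $A\tau=P\tau_D+Q\frac{\operatorname{tr}\tau}{N}I$ for all $\tau\in\mathbb M$, where $\tau_D=\tau-\frac{\operatorname{tr}\tau}{N}I$ and $P,Q$ are positive scalar functions on $\Omega$. Mesh. $\Omega_h$ is a mesh: a finite collection of disjoint open elements $K$ with $\bigcup_{K\in\Omega_h}\bar K=\bar\Omega$, each $K$ having Lipschitz, piecewise planar boundary (a Lipschitz polygon if $N=2$, a Lipschitz polyhedron if $N=3$). $n$ is the outward unit normal on $\partial K$; $In|_{\partial\Omega_h}$ is the element whose restriction to each $\partial K$ is $In=n$. Write $(r,s)_{\Omega_h}=\sum_K(r,s)_K$ with $(\cdot,\cdot)_K$ the $L^2(K)$ inner product, and $\langle w,l\rangle_{\partial\Omega_h}=\sum_K\langle w,l\rangle_{1/2,\partial K}$ with $\langle\cdot,l\rangle_{1/2,\partial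 K}$ the action of $l\in H^{-1/2}(\partial K)$ on $H^{1/2}(\partial K)$. Differential operators on broken spaces are taken element by element. Spaces. $H_0^{1/2}(\partial\Omega_h;\mathbb V)=\{\eta:\exists w\in H_0^1(\Omega;\mathbb V)\text{ with }\eta|_{\partial K}=w|_{\partial K}\ \forall K\in\Omega_h\}$. $H^{-1/2}(\partial\Omega_h;\mathbb V)=\{\eta\in\prod_{K}H^{-1/2}(\partial K;\mathbb V):\exists q\in H(\mathrm{div},\Omega;\mathbb M)\text{ with }\eta|_{\partial K}=q\,n|_{\partial K}\ \forall K\in\Omega_h\}$. $H(\mathrm{div},\Omega_h;\mathbb S)=\{\tau:\tau|_K\in H(\mathrm{div},K;\mathbb S)\ \forall K\}$ with $\|\tau\|^2_{H(\mathrm{div},\Omega_h)}=(\tau,\tau)_{\Omega_h}+(\operatorname{div}\tau,\operatorname{div}\tau)_{\Omega_h}$; $H^1(\Omega_h;\mathbb V)=\{v:v|_K\in H^1(K;\mathbb V)\ \forall K\}$ with $\|v\|^2_{H^1(\Omega_h)}=(v,v)_{\Omega_h}+(\nabla v,\nabla v)_{\Omega_h}$. First formulation. $U=L^2(\Omega;\mathbb M)\times L^2(\Omega;\mathbb V)\times H_0^{1/2}(\partial\Omega_h;\mathbb V)\times H^{-1/2}(\partial\Omega_h;\mathbb V)$; $V=H(\mathrm{div},\Omega_h;\mathbb S)\times H^1(\Omega_h;\mathbb V)\times L^2(\Omega;\mathbb K)$ with $\|(\tau,v,q)\|_V^2=\|\tau\|^2_{H(\mathrm{div},\Omega_h)}+\|v\|^2_{H^1(\Omega_h)}+\|q\|^2_\Omega$;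 $$b((\sigma,u,\hat u,\hat\sigma_n),(\tau,v,q))=(A\sigma,\tau)_{\Omega_h}+(u,\operatorname{div}\tau)_{\Omega_h}-\langle\hat u,\tau n\rangle_{\partial\Omega_h}+(\sigma,\nabla v)_{\Omega_h}-\langle v,\hat\sigma_n\rangle_{\partial\Omega_h}+(\sigma,q)_{\Omega_h};$$ $T:U\to V$ is defined by $(T\mathcal U,\mathcal V)_V=b(\mathcal U,\mathcal V)$ for all $\mathcal V\in V$. Second formulation. $U^{(2)}=U\times\mathbb R$, $V^{(2)}=V\times\mathbb R$ with $\|(\tau,v,q,\beta)\|_{V^{(2)}}^2=\|(\tau,v,q)\|_V^2+|\beta|^2$; $$b^{(2)}((\sigma,u,\hat u,\hat\sigma_n,\alpha),(\tau,v,q,\beta))=b((\sigma,u,\hat u,\hat\sigma_n),(\tau,v,q))+Q_0^{-1}(\alpha I,A\tau)_{\Omega_h}+Q_0^{-1}(A\sigma,\beta I)_{\Omega_h};$$ $T^{(2)}:U^{(2)}\to V^{(2)}$ is defined by $(T^{(2)}\mathcal U,\mathcal V)_{V^{(2)}}=b^{(2)}(\mathcal U,\mathcal V)$ for all $\mathcal V\in V^{(2)}$. *)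

theory Defs
  imports "HOL-Analysis.Analysis" "HOL-Library.Function_Algebras"
begin

instantiation "fun" :: (type, real_vector) real_vector
begin

definition scaleR_fun :: "real \<Rightarrow> ('a \<Rightarrow> 'b) \<Rightarrow> 'a \<Rightarrow> 'b"
  where "scaleR_fun c f = (\<lambda>x. c *\<^sub>R f x)"

instance
  by standard (auto simp: scaleR_fun_def plus_fun_def fun_eq_iff algebra_simps)

end

text \<open>
  A quotient vector space \<open>X / Z\<close> (for instance functions modulo almost everywhere equality) is
  represented by the set \<open>X\<close> of representatives together with the subspace \<open>Z\<close> of representatives
  of zero.  Subspaces of \<open>X / Z\<close> correspond to the subspaces \<open>S\<close> with \<open>Z \<subseteq> S \<subseteq> X\<close>.
\<close>

definition quot_subspace :: "'a::real_vector set \<Rightarrow> 'a set \<Rightarrow> 'a set \<Rightarrow> bool"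
  where "quot_subspace X Z S \<longleftrightarrow> subspace S \<and> Z \<subseteq> S \<and> S \<subseteq> X"

definition quot_finite_dim :: "'a::real_vector set \<Rightarrow> 'a set \<Rightarrow> bool"
  where "quot_finite_dim Z S \<longleftrightarrow> (\<exists>B. finite B \<and> S = span (B \<union> Z))"

text \<open>Near each boundary point, \<open>S\<close> is the strict subgraph, in some direction \<open>e\<close>, of a Lipschitz
  function of the coordinates orthogonal to \<open>e\<close>.\<close>

definition lipschitz_boundary :: "(real^'n) set \<Rightarrow> bool"
  where "lipschitz_boundary S \<longleftrightarrow>
    (\<forall>x\<in>frontier S. \<exists>e r L g. norm e = 1 \<and> 0 < r \<and> L-lipschitz_on {y. y \<bullet> e = 0} g \<and>
       (\<forall>y\<in>ball x r. y \<in> S \<longleftrightarrow> y \<bullet> e < (g :: real^'n \<Rightarrow> real) (y - (y \<bullet> e) *\<^sub>R e)))"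

definition piecewise_planar_boundary :: "(real^'n) set \<Rightarrow> bool"
  where "piecewise_planar_boundary S \<longleftrightarrow>
    (\<exists>H. finite H \<and> (\<forall>h\<in>H. \<exists>a b. a \<noteq> 0 \<and> h = {x. a \<bullet> x = b}) \<and> frontier S \<subseteq> \<Union>H)"

definition mesh :: "(real^'n) set \<Rightarrow> (real^'n) set set \<Rightarrow> bool"
  where "mesh \<Omega> \<T> \<longleftrightarrow> finite \<T> \<and> pairwise disjnt \<T> \<and>
    (\<forall>K\<in>\<T>. open K \<and> lipschitz_boundary K \<and> piecewise_planar_boundary K) \<and>
    (\<Union>K\<in>\<T>. closure K) = closure \<Omega>"

definition L2 :: "(real^'n) set \<Rightarrow> (real^'n \<Rightarrow> 'b::euclidean_space) set"
  where "L2 S = {f \<in> borel_measurable (lebesgue_on S).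
                  integrable (lebesgue_on S) (\<lambda>x. (norm (f x))\<^sup>2)}"

definition ae_zero :: "(real^'n) set \<Rightarrow> (real^'n \<Rightarrow> 'b::euclidean_space) set"
  where "ae_zero S = {f. AE x in lebesgue_on S. f x = 0}"

definition l2_inner ::
    "(real^'n) set \<Rightarrow> (real^'n \<Rightarrow> 'b::euclidean_space) \<Rightarrow> (real^'n \<Rightarrow> 'b) \<Rightarrow> real"
  where "l2_inner S f g = (LINT x|lebesgue_on S. f x \<bullet> g x)"

definition pderiv_fun :: "'n \<Rightarrow> (real^'n \<Rightarrow> real) \<Rightarrow> real^'n \<Rightarrow> real"
  where "pderiv_fun j \<phi> x = frechet_derivative \<phi> (at x) (axis j 1)"

primrec Ck :: "nat \<Rightarrow> (real^'n \<Rightarrow> real) \<Rightarrow> bool" where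
  "Ck 0 \<phi> = continuous_on UNIV \<phi>"
| "Ck (Suc k) \<phi> = ((\<forall>x. \<phi> differentiable (at x)) \<and> (\<forall>j. Ck k (pderiv_fun j \<phi>)))"

definition test_functions :: "(real^'n) set \<Rightarrow> (real^'n \<Rightarrow> real) set"
  where "test_functions S =
    {\<phi>. (\<forall>k. Ck k \<phi>) \<and> compact (closure {x. \<phi> x \<noteq> 0}) \<and> closure {x. \<phi> x \<noteq> 0} \<subseteq> S}"

definition is_weak_grad ::
    "(real^'n) set \<Rightarrow> (real^'n \<Rightarrow> real^'n) \<Rightarrow> (real^'n \<Rightarrow> real^'n^'n) \<Rightarrow> bool"
  where "is_weak_grad S v G \<longleftrightarrow> (\<forall>\<phi>\<in>test_functions S. \<forall>i j.
    (LINT x|lebesgue_on S. v x $ i * pderiv_fun j \<phi> x) = - (LINT x|lebesgue_on S. G x $ i $ j * \<phi> x))"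

definition is_weak_div ::
    "(real^'n) set \<Rightarrow> (real^'n \<Rightarrow> real^'n^'n) \<Rightarrow> (real^'n \<Rightarrow> real^'n) \<Rightarrow> bool"
  where "is_weak_div S \<tau> d \<longleftrightarrow> (\<forall>\<phi>\<in>test_functions S. \<forall>i.
    (LINT x|lebesgue_on S. (\<Sum>j\<in>UNIV. \<tau> x $ i $ j * pderiv_fun j \<phi> x)) =
      - (LINT x|lebesgue_on S. d x $ i * \<phi> x))"

definition H1 :: "(real^'n) set \<Rightarrow> (real^'n \<Rightarrow> real^'n) set"
  where "H1 S = {v \<in> L2 S. \<exists>G\<in>L2 S. is_weak_grad S v G}"

definition Hdiv :: "(real^'n) set \<Rightarrow> (real^'n \<Rightarrow> real^'n^'n) set"
  where "Hdiv S = {\<tau> \<in> L2 S. \<exists>d\<in>L2 S. is_weak_div S \<tau> d}"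

definition wgrad :: "(real^'n) set \<Rightarrow> (real^'n \<Rightarrow> real^'n) \<Rightarrow> real^'n \<Rightarrow> real^'n^'n"
  where "wgrad S v = (SOME G. G \<in> L2 S \<and> is_weak_grad S v G)"

definition wdiv :: "(real^'n) set \<Rightarrow> (real^'n \<Rightarrow> real^'n^'n) \<Rightarrow> real^'n \<Rightarrow> real^'n"
  where "wdiv S \<tau> = (SOME d. d \<in> L2 S \<and> is_weak_div S \<tau> d)"

definition H1_norm :: "(real^'n) set \<Rightarrow> (real^'n \<Rightarrow> real^'n) \<Rightarrow> real"
  where "H1_norm S v = sqrt (l2_inner S v v + l2_inner S (wgrad S v) (wgrad S v))"

definition H10 :: "(real^'n) set \<Rightarrow> (real^'n \<Rightarrow> real^'n) set"
  where "H10 S = {w \<in> H1 S. \<exists>\<phi>. (\<forall>k i. (\<lambda>x. \<phi> k x $ i) \<in> test_functions S) \<and>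
                    (\<lambda>k::nat. H1_norm S (w - \<phi> k)) \<longlonglongrightarrow> 0}"

text \<open>
  The trace space on \<open>\<partial>K\<close> is the quotient of \<open>H1 K\<close> by the kernel \<open>H10 K\<close> of the trace map, so a
  trace is represented by any of its liftings to \<open>K\<close>.  The space \<open>Hmhalf K\<close> is its dual: the
  functionals on \<open>H1 K\<close> that vanish on \<open>H10 K\<close> and are bounded (a bound in the norm of \<open>H1 K\<close> is
  the same as a bound in the quotient norm).  The duality pairing is function application.
\<close>

definition same_trace :: "(real^'n) set \<Rightarrow> (real^'n \<Rightarrow> real^'n) \<Rightarrow> (real^'n \<Rightarrow> real^'n) \<Rightarrow> bool"
  where "same_trace K w w' \<longleftrightarrow> w - w' \<in> H10 K"

definition Hmhalf :: "(real^'n) set \<Rightarrow> ((real^'n \<Rightarrow> real^'n) \<Rightarrow> real) set"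
  where "Hmhalf K = {l.
    (\<forall>v\<in>H1 K. \<forall>w\<in>H1 K. \<forall>a b. l (a *\<^sub>R v + b *\<^sub>R w) = a * l v + b * l w) \<and>
    (\<forall>w\<in>H10 K. l w = 0) \<and>
    (\<exists>C. \<forall>w\<in>H1 K. \<bar>l w\<bar> \<le> C * H1_norm K w)}"

text \<open>The normal trace \<open>\<tau> n\<close> on \<open>\<partial>K\<close> as a functional on traces, by Green's formula.\<close>

definition normal_trace ::
    "(real^'n) set \<Rightarrow> (real^'n \<Rightarrow> real^'n^'n) \<Rightarrow> (real^'n \<Rightarrow> real^'n) \<Rightarrow> real"
  where "normal_trace K \<tau> w = l2_inner K \<tau> (wgrad K w) + l2_inner K (wdiv K \<tau>) w"

text \<open>Elements of the skeleton spaces are families indexed by the elements \<open>K\<close> of the mesh; the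
  entries at sets outside the mesh are irrelevant.\<close>

definition H0half_skel ::
    "(real^'n) set \<Rightarrow> (real^'n) set set \<Rightarrow> ((real^'n) set \<Rightarrow> real^'n \<Rightarrow> real^'n) set"
  where "H0half_skel \<Omega> \<T> = {\<eta>. (\<forall>K\<in>\<T>. \<eta> K \<in> H1 K) \<and>
    (\<exists>w\<in>H10 \<Omega>. \<forall>K\<in>\<T>. same_trace K (\<eta> K) w)}"

definition H0half_skel_zero ::
    "(real^'n) set set \<Rightarrow> ((real^'n) set \<Rightarrow> real^'n \<Rightarrow> real^'n) set"
  where "H0half_skel_zero \<T> = {\<eta>. \<forall>K\<in>\<T>. \<eta> K \<in> H10 K}"

definition Hmhalf_skel ::
    "(real^'n) set \<Rightarrow> (real^'n) set set \<Rightarrow> ((real^'n) set \<Rightarrow> (real^'n \<Rightarrow> real^'n) \<Rightarrow> real) set"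
  where "Hmhalf_skel \<Omega> \<T> = {\<eta>. (\<forall>K\<in>\<T>. \<eta> K \<in> Hmhalf K) \<and>
    (\<exists>q\<in>Hdiv \<Omega>. \<forall>K\<in>\<T>. \<forall>w\<in>H1 K. \<eta> K w = normal_trace K q w)}"

definition Hmhalf_skel_zero ::
    "(real^'n) set set \<Rightarrow> ((real^'n) set \<Rightarrow> (real^'n \<Rightarrow> real^'n) \<Rightarrow> real) set"
  where "Hmhalf_skel_zero \<T> = {\<eta>. \<forall>K\<in>\<T>. \<forall>w\<in>H1 K. \<eta> K w = 0}"

definition duality_skel ::
    "(real^'n) set set \<Rightarrow> ((real^'n) set \<Rightarrow> real^'n \<Rightarrow> real^'n) \<Rightarrow>
     ((real^'n) set \<Rightarrow> (real^'n \<Rightarrow> real^'n) \<Rightarrow> real) \<Rightarrow> real"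
  where "duality_skel \<T> w l = (\<Sum>K\<in>\<T>. l K (w K))"

definition l2_inner_broken ::
    "(real^'n) set set \<Rightarrow> (real^'n \<Rightarrow> 'b::euclidean_space) \<Rightarrow> (real^'n \<Rightarrow> 'b) \<Rightarrow> real"
  where "l2_inner_broken \<T> r s = (\<Sum>K\<in>\<T>. l2_inner K r s)"

definition Hdiv_sym_broken :: "(real^'n) set set \<Rightarrow> (real^'n \<Rightarrow> real^'n^'n) set"
  where "Hdiv_sym_broken \<T> =
    {\<tau>. \<forall>K\<in>\<T>. \<tau> \<in> Hdiv K \<and> (AE x in lebesgue_on K. transpose (\<tau> x) = \<tau> x)}"

definition H1_broken :: "(real^'n) set set \<Rightarrow> (real^'n \<Rightarrow> real^'n) set"
  where "H1_broken \<T> = {v. \<forall>K\<in>\<T>. v \<in> H1 K}"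

definition L2_skew :: "(real^'n) set \<Rightarrow> (real^'n \<Rightarrow> real^'n^'n) set"
  where "L2_skew \<Omega> = {q \<in> L2 \<Omega>. AE x in lebesgue_on \<Omega>. transpose (q x) = - q x}"

definition compliance :: "(real^'n) set \<Rightarrow> (real^'n \<Rightarrow> real^'n^'n \<Rightarrow> real^'n^'n) \<Rightarrow> bool"
  where "compliance \<Omega> A \<longleftrightarrow>
    (AE x in lebesgue_on \<Omega>. linear (A x) \<and> (\<forall>\<sigma> \<tau>. A x \<sigma> \<bullet> \<tau> = \<sigma> \<bullet> A x \<tau>)) \<and>
    (\<exists>c>0. AE x in lebesgue_on \<Omega>. \<forall>\<tau>. c * (\<tau> \<bullet> \<tau>) \<le> A x \<tau> \<bullet> \<tau>) \<and>
    (\<forall>E\<in>Basis. \<forall>F\<in>Basis. (\<lambda>x. A x E \<bullet> F) \<in> borel_measurable (lebesgue_on \<Omega>) \<and>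
       (\<exists>C. AE x in lebesgue_on \<Omega>. \<bar>A x E \<bullet> F\<bar> \<le> C))"

definition ess_inf :: "(real^'n) set \<Rightarrow> (real^'n \<Rightarrow> real) \<Rightarrow> real"
  where "ess_inf S g = Sup {c. AE x in lebesgue_on S. c \<le> g x}"

definition Q0 :: "(real^'n) set \<Rightarrow> (real^'n \<Rightarrow> real^'n^'n \<Rightarrow> real^'n^'n) \<Rightarrow> real"
  where "Q0 \<Omega> A = ess_inf \<Omega> (\<lambda>x. trace (A x (mat 1)) / real CARD('n))"

definition deviatoric :: "real^'n^'n \<Rightarrow> real^'n^'n"
  where "deviatoric \<tau> = \<tau> - (trace \<tau> / real CARD('n)) *\<^sub>R mat 1"

definition isotropic ::
    "(real^'n) set \<Rightarrow> (real^'n \<Rightarrow> real^'n^'n \<Rightarrow> real^'n^'n) \<Rightarrow>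
     (real^'n \<Rightarrow> real) \<Rightarrow> (real^'n \<Rightarrow> real) \<Rightarrow> bool"
  where "isotropic \<Omega> A P Q \<longleftrightarrow> (\<forall>x\<in>\<Omega>. 0 < P x \<and> 0 < Q x) \<and>
    (AE x in lebesgue_on \<Omega>. \<forall>\<tau>.
       A x \<tau> = P x *\<^sub>R deviatoric \<tau> + (Q x * (trace \<tau> / real CARD('n))) *\<^sub>R mat 1)"

type_synonym 'n trial =
  "(real^'n \<Rightarrow> real^'n^'n) \<times> (real^'n \<Rightarrow> real^'n) \<times> ((real^'n) set \<Rightarrow> real^'n \<Rightarrow> real^'n) \<times>
   ((real^'n) set \<Rightarrow> (real^'n \<Rightarrow> real^'n) \<Rightarrow> real)"

type_synonym 'n trial2 =
  "(real^'n \<Rightarrow> real^'n^'n) \<times> (real^'n \<Rightarrow> real^'n) \<times> ((real^'n) set \<Rightarrow> real^'n \<Rightarrow> real^'n) \<times>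
   ((real^'n) set \<Rightarrow> (real^'n \<Rightarrow> real^'n) \<Rightarrow> real) \<times> real"

type_synonym 'n testf =
  "(real^'n \<Rightarrow> real^'n^'n) \<times> (real^'n \<Rightarrow> real^'n) \<times> (real^'n \<Rightarrow> real^'n^'n)"

type_synonym 'n testf2 =
  "(real^'n \<Rightarrow> real^'n^'n) \<times> (real^'n \<Rightarrow> real^'n) \<times> (real^'n \<Rightarrow> real^'n^'n) \<times> real"

definition trial_zero :: "(real^'n) set \<Rightarrow> (real^'n) set set \<Rightarrow> 'n::finite trial set"
  where "trial_zero \<Omega> \<T> = ae_zero \<Omega> \<times> ae_zero \<Omega> \<times> H0half_skel_zero \<T> \<times> Hmhalf_skel_zero \<T>"

definition V_space :: "(real^'n) set \<Rightarrow> (real^'n) set set \<Rightarrow> 'n::finite testf set"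
  where "V_space \<Omega> \<T> = Hdiv_sym_broken \<T> \<times> H1_broken \<T> \<times> L2_skew \<Omega>"

definition V_inner ::
    "(real^'n) set \<Rightarrow> (real^'n) set set \<Rightarrow> 'n::finite testf \<Rightarrow> 'n testf \<Rightarrow> real"
  where "V_inner \<Omega> \<T> = (\<lambda>(\<tau>, v, q) (\<tau>', v', q').
    l2_inner_broken \<T> \<tau> \<tau>' + (\<Sum>K\<in>\<T>. l2_inner K (wdiv K \<tau>) (wdiv K \<tau>')) +
    l2_inner_broken \<T> v v' + (\<Sum>K\<in>\<T>. l2_inner K (wgrad K v) (wgrad K v')) +
    l2_inner \<Omega> q q')"

definition b_form ::
    "(real^'n) set set \<Rightarrow> (real^'n \<Rightarrow> real^'n^'n \<Rightarrow> real^'n^'n) \<Rightarrow>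
     'n::finite trial \<Rightarrow> 'n testf \<Rightarrow> real"
  where "b_form \<T> A = (\<lambda>(\<sigma>, u, uh, sn) (\<tau>, v, q).
    l2_inner_broken \<T> (\<lambda>x. A x (\<sigma> x)) \<tau> +
    (\<Sum>K\<in>\<T>. l2_inner K u (wdiv K \<tau>)) -
    duality_skel \<T> uh (\<lambda>K. normal_trace K \<tau>) +
    (\<Sum>K\<in>\<T>. l2_inner K \<sigma> (wgrad K v)) -
    duality_skel \<T> (\<lambda>K. v) sn +
    l2_inner_broken \<T> \<sigma> q)"

text \<open>The operator \<open>T\<close> is a relation here, since its value is determined only up to functions that vanish
  almost everywhere.\<close>

definition is_T ::
    "(real^'n) set \<Rightarrow> (real^'n) set set \<Rightarrow> (real^'n \<Rightarrow> real^'n^'n \<Rightarrow> real^'n^'n) \<Rightarrow>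
     'n::finite trial \<Rightarrow> 'n testf \<Rightarrow> bool"
  where "is_T \<Omega> \<T> A \<U> \<V> \<longleftrightarrow> \<V> \<in> V_space \<Omega> \<T> \<and>
    (\<forall>\<W>\<in>V_space \<Omega> \<T>. V_inner \<Omega> \<T> \<V> \<W> = b_form \<T> A \<U> \<W>)"

definition T_image ::
    "(real^'n) set \<Rightarrow> (real^'n) set set \<Rightarrow> (real^'n \<Rightarrow> real^'n^'n \<Rightarrow> real^'n^'n) \<Rightarrow>
     'n::finite trial set \<Rightarrow> 'n testf set"
  where "T_image \<Omega> \<T> A Uh = {\<V>. \<exists>\<U>\<in>Uh. is_T \<Omega> \<T> A \<U> \<V>}"

definition solves_dpg ::
    "(real^'n) set \<Rightarrow> (real^'n) set set \<Rightarrow> (real^'n \<Rightarrow> real^'n^'n \<Rightarrow> real^'n^'n) \<Rightarrow>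
     (real^'n \<Rightarrow> real^'n) \<Rightarrow> 'n::finite trial set \<Rightarrow> 'n trial \<Rightarrow> bool"
  where "solves_dpg \<Omega> \<T> A f Uh \<U> \<longleftrightarrow> \<U> \<in> Uh \<and>
    (\<forall>(\<tau>, v, q)\<in>T_image \<Omega> \<T> A Uh. b_form \<T> A \<U> (\<tau>, v, q) = l2_inner \<Omega> f v)"

definition extend_trial :: "'n::finite trial set \<Rightarrow> 'n trial2 set"
  where "extend_trial Uh = {(\<sigma>, u, uh, sn, \<alpha>). (\<sigma>, u, uh, sn) \<in> Uh}"

definition V2_space :: "(real^'n) set \<Rightarrow> (real^'n) set set \<Rightarrow> 'n::finite testf2 set"
  where "V2_space \<Omega> \<T> = Hdiv_sym_broken \<T> \<times> H1_broken \<T> \<times> L2_skew \<Omega> \<times> UNIV"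

definition V2_inner ::
    "(real^'n) set \<Rightarrow> (real^'n) set set \<Rightarrow> 'n::finite testf2 \<Rightarrow> 'n testf2 \<Rightarrow> real"
  where "V2_inner \<Omega> \<T> = (\<lambda>(\<tau>, v, q, \<beta>) (\<tau>', v', q', \<beta>').
    V_inner \<Omega> \<T> (\<tau>, v, q) (\<tau>', v', q') + \<beta> * \<beta>')"

definition b2_form ::
    "(real^'n) set \<Rightarrow> (real^'n) set set \<Rightarrow> (real^'n \<Rightarrow> real^'n^'n \<Rightarrow> real^'n^'n) \<Rightarrow>
     'n::finite trial2 \<Rightarrow> 'n testf2 \<Rightarrow> real"
  where "b2_form \<Omega> \<T> A = (\<lambda>(\<sigma>, u, uh, sn, \<alpha>) (\<tau>, v, q, \<beta>).
    b_form \<T> A (\<sigma>, u, uh, sn) (\<tau>, v, q) +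
    inverse (Q0 \<Omega> A) * l2_inner_broken \<T> (\<lambda>x. \<alpha> *\<^sub>R mat 1) (\<lambda>x. A x (\<tau> x)) +
    inverse (Q0 \<Omega> A) * l2_inner_broken \<T> (\<lambda>x. A x (\<sigma> x)) (\<lambda>x. \<beta> *\<^sub>R mat 1))"

definition is_T2 ::
    "(real^'n) set \<Rightarrow> (real^'n) set set \<Rightarrow> (real^'n \<Rightarrow> real^'n^'n \<Rightarrow> real^'n^'n) \<Rightarrow>
     'n::finite trial2 \<Rightarrow> 'n testf2 \<Rightarrow> bool"
  where "is_T2 \<Omega> \<T> A \<U> \<V> \<longleftrightarrow> \<V> \<in> V2_space \<Omega> \<T> \<and>
    (\<forall>\<W>\<in>V2_space \<Omega> \<T>. V2_inner \<Omega> \<T> \<V> \<W> = b2_form \<Omega> \<T> A \<U> \<W>)"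

definition T2_image ::
    "(real^'n) set \<Rightarrow> (real^'n) set set \<Rightarrow> (real^'n \<Rightarrow> real^'n^'n \<Rightarrow> real^'n^'n) \<Rightarrow>
     'n::finite trial2 set \<Rightarrow> 'n testf2 set"
  where "T2_image \<Omega> \<T> A Uh = {\<V>. \<exists>\<U>\<in>Uh. is_T2 \<Omega> \<T> A \<U> \<V>}"

definition solves_dpg2 ::
    "(real^'n) set \<Rightarrow> (real^'n) set set \<Rightarrow> (real^'n \<Rightarrow> real^'n^'n \<Rightarrow> real^'n^'n) \<Rightarrow>
     (real^'n \<Rightarrow> real^'n) \<Rightarrow> 'n::finite trial2 set \<Rightarrow> 'n trial2 \<Rightarrow> bool"
  where "solves_dpg2 \<Omega> \<T> A f Uh \<U> \<longleftrightarrow> \<U> \<in> Uh \<and>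
    (\<forall>(\<tau>, v, q, \<beta>)\<in>T2_image \<Omega> \<T> A Uh. b2_form \<Omega> \<T> A \<U> (\<tau>, v, q, \<beta>) = l2_inner \<Omega> f v)"

end

theory Submission
  imports Defs
begin

text \<open>
  Let \<open>E = (I, 0, 0, I n)\<close>.  Since \<open>A I = Q\<^sub>0 I\<close>, Green's formula gives
  \<open>b(E, (\<tau>, v, q)) = Q\<^sub>0 \<integral> tr \<tau>\<close>, and \<open>b\<^sub>2((\<U>, \<alpha>), (\<V>, \<beta>)) = b(\<U>, \<V>) + \<alpha> \<integral> tr \<tau> + \<beta> \<integral> tr \<sigma>\<close>.
  Hence the \<open>V\<close> component of \<open>T\<^sub>2(\<U>, \<alpha>)\<close> is \<open>T(\<U> + (\<alpha> / Q\<^sub>0) E)\<close>, so both methods use the same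
  test functions in \<open>V\<close>, and they agree as soon as \<open>\<integral> tr \<sigma>\<^sub>h = 0\<close>.
  A solution of the first method has this property because \<open>T E = (Q\<^sub>0 I, 0, 0)\<close> is a test function and
  the flux of \<open>I n\<close> against a trace of an \<open>H\<^sub>0\<^sup>1\<close> function vanishes; a solution of the second because
  \<open>T\<^sub>2(E, - Q\<^sub>0) = (0, 0, 0, N |\<Omega>|)\<close>.

  Weak derivatives are chosen representatives, so all this needs their uniqueness almost everywhere, that is
  the fundamental lemma of the calculus of variations.
\<close>

section \<open>Test functions\<close>

text \<open>\<open>is_T\<close> and \<open>is_T2\<close> are relations, so a test function is placed
  in an image by verifying the defining identity for an explicit pair. Isotropy with constant
  \<open>Q\<close> enters in two forms: \<open>tr (A \<tau>) = Q0 tr \<tau>\<close> and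
  \<open>A (\<tau> + c I) = A \<tau> + c Q0 I\<close>. The second lets a shift of the trial function
  absorb the \<alpha> term, and the shift stays in the discrete space because \<open>I\<close> and
  \<open>I n\<close> belong to it. The vanishing flux comes from Green's formula: on an element the
  flux of \<open>I n\<close> is the integral of the divergence of a lifting, a change of lifting by
  \<open>H10 K\<close> does not affect it, and the element integrals add up over
  \<open>\<Omega>\<close>. The sum rests on mesh geometry: elements lie in \<open>\<Omega>\<close>,
  where the Lipschitz condition excludes slits, and they fill it up to a null set. Gradients on an
  element and on \<open>\<Omega>\<close> are independent choices, so even passing from one domain to
  the other uses uniqueness.\<close>

lemma pderiv_fun_eq:
  assumes "(\<phi> has_derivative D) (at x)"
  shows "pderiv_fun j \<phi> x = D (axis j 1)"
  using frechet_derivative_at[OF assms] by (simp add: pderiv_fun_def)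

section \<open>Calculus for the classes \<open>Ck\<close>\<close>

lemma Ck_Suc_imp: "Ck (Suc k) \<phi> \<Longrightarrow> Ck k \<phi>"
proof (induction k arbitrary: \<phi>)
  case 0
  then show ?case
    by (auto intro!: continuous_at_imp_continuous_on differentiable_imp_continuous_within)
next
  case (Suc k)
  then show ?case by (metis Ck.simps(2))
qed

lemma Ck_const: "Ck k (\<lambda>x::real^'n. c)"
proof (induction k arbitrary: c)
  case (Suc k)
  have "pderiv_fun j (\<lambda>x::real^'n. c) = (\<lambda>x. 0)" for j
    by (rule ext) (simp add: pderiv_fun_eq[OF has_derivative_const])
  with Suc show ?case by simp
qed simp

lemma Ck_add:
  assumes "Ck k \<phi>" "Ck k \<psi>"
  shows "Ck k (\<lambda>x. \<phi> x + \<psi> x)"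
  using assms
proof (induction k arbitrary: \<phi> \<psi>)
  case 0
  then show ?case by (simp add: continuous_on_add)
next
  case (Suc k)
  then have d: "\<phi> differentiable at x" "\<psi> differentiable at x" for x by auto
  have "pderiv_fun j (\<lambda>x. \<phi> x + \<psi> x) = (\<lambda>x. pderiv_fun j \<phi> x + pderiv_fun j \<psi> x)" for j
    using pderiv_fun_eq[OF has_derivative_add[OF d[THEN frechet_derivative_works[THEN iffD1]]]]
    by (auto simp: pderiv_fun_def)
  with Suc d show ?case by simp
qed

lemma pderiv_fun_mult:
  assumes "\<phi> differentiable at x" "\<psi> differentiable at x"
  shows "pderiv_fun j (\<lambda>x. \<phi> x * \<psi> x) x = \<phi> x * pderiv_fun j \<psi> x + pderiv_fun j \<phi> x * \<psi> x"
  using pderiv_fun_eq[OF has_derivative_mult[OF assms[THEN frechet_derivative_works[THEN iffD1]]]]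
  by (simp add: pderiv_fun_def)

lemma Ck_mult:
  assumes "Ck k \<phi>" "Ck k \<psi>"
  shows "Ck k (\<lambda>x. \<phi> x * \<psi> x)"
  using assms
proof (induction k arbitrary: \<phi> \<psi>)
  case 0
  then show ?case by (simp add: continuous_on_mult)
next
  case (Suc k)
  then have d: "\<phi> differentiable at x" "\<psi> differentiable at x" for x by auto
  have "pderiv_fun j (\<lambda>x. \<phi> x * \<psi> x) = (\<lambda>x. \<phi> x * pderiv_fun j \<psi> x + pderiv_fun j \<phi> x * \<psi> x)" for j
    by (rule ext) (rule pderiv_fun_mult[OF d])
  \<comment> \<open>The product rule returns the factors undifferentiated, so
    \<open>Ck_Suc_imp\<close> lowers their order to \<open>k\<close> before the induction hypothesis
    applies.\<close>
  moreover have "Ck k (\<lambda>x. \<phi> x * pderiv_fun j \<psi> x + pderiv_fun j \<phi> x * \<psi> x)" for j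
    using Suc.prems Suc.prems[THEN Ck_Suc_imp] by (intro Ck_add Suc.IH) auto
  ultimately show ?case using d by simp
qed

lemma Ck_prod:
  assumes "finite I" "\<And>i. i \<in> I \<Longrightarrow> Ck k (\<phi> i)"
  shows "Ck k (\<lambda>x. \<Prod>i\<in>I. \<phi> i x)"
  using assms by (induction rule: finite_induct) (auto intro: Ck_const Ck_mult)

text \<open>The derivatives of \<open>exp (- 1 / t)\<close> are combinations of the functions \<open>t\<^sup>-\<^sup>k exp (- 1 / t)\<close>, all
  extended by zero to \<open>t \<le> 0\<close>.\<close>

definition flat_exp :: "nat \<Rightarrow> real \<Rightarrow> real"
  where "flat_exp k t = (if 0 < t then inverse t ^ k * exp (- inverse t) else 0)"

text \<open>Under \<open>s = 1 / t\<close> the right limit becomes that of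
  \<open>s ^ k / exp s\<close> at infinity; on the left the function is constant.\<close>

lemma flat_exp_tendsto_0: "(flat_exp k \<longlongrightarrow> 0) (at 0)"
proof -
  have "((\<lambda>t::real. inverse t ^ k / exp (inverse t)) \<longlongrightarrow> 0) (at_right 0)"
    by (rule filterlim_compose[OF tendsto_power_div_exp_0 filterlim_inverse_at_top_right])
  then have "(flat_exp k \<longlongrightarrow> 0) (at_right 0)"
    by (rule Lim_transform_eventually)
      (auto simp: eventually_at_filter flat_exp_def exp_minus divide_inverse)
  moreover have "(flat_exp k \<longlongrightarrow> 0) (at_left 0)"
    by (rule tendsto_eventually) (auto simp: eventually_at_filter flat_exp_def)
  ultimately show ?thesis by (simp add: filterlim_split_at)
qed

lemma DERIV_flat_exp:
  "(flat_exp k has_real_derivative flat_exp (k + 2) t - of_nat k * flat_exp (k + 1) t) (at t)"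
proof (cases t "0::real" rule: linorder_cases)
  case less
  have "((\<lambda>t. 0) has_real_derivative 0) (at t)" by simp
  then have "(flat_exp k has_real_derivative 0) (at t)"
    by (rule has_field_derivative_transform_within_open[where S="{..<0}"])
      (use less in \<open>auto simp: flat_exp_def\<close>)
  then show ?thesis using less by (simp add: flat_exp_def)
next
  case equal
  \<comment> \<open>Dividing by \<open>s\<close> raises the exponent: away from 0 the difference
    quotient is \<open>flat_exp (Suc k)\<close>, whose limit is known.\<close>
  have "((\<lambda>s. (flat_exp k s - flat_exp k 0) / (s - 0)) \<longlongrightarrow> 0) (at 0)"
    by (rule Lim_transform_eventually[OF flat_exp_tendsto_0[of "Suc k"]])
      (auto simp: flat_exp_def field_simps)
  then have "(flat_exp k has_real_derivative 0) (at 0)"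
    by (simp add: has_field_derivative_iff)
  then show ?thesis using equal by (simp add: flat_exp_def)
next
  case greater
  have "((\<lambda>t. inverse t ^ k * exp (- inverse t)) has_real_derivative
     flat_exp (k + 2) t - of_nat k * flat_exp (k + 1) t) (at t)"
  \<comment> \<open>The power rule used is stated for successor exponents; for \<open>k = 0\<close>
    the second term has coefficient 0.\<close>
  proof (cases k)
    case 0
    then show ?thesis using greater
      by (auto intro!: derivative_eq_intros simp: flat_exp_def power2_eq_square)
  next
    case (Suc m)
    have "((\<lambda>t. inverse t ^ Suc m * exp (- inverse t)) has_real_derivative
       (1 + of_nat m) * (- (inverse t * 1 * inverse t) * inverse t ^ m) * exp (- inverse t) +
       exp (- inverse t) * - (- (inverse t * 1 * inverse t)) * inverse t ^ Suc m) (at t)"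
      using greater by (intro DERIV_mult DERIV_power_Suc DERIV_inverse' DERIV_ident DERIV_fun_exp DERIV_minus) auto
    with Suc greater show ?thesis
      by (simp add: flat_exp_def power2_eq_square algebra_simps)
  qed
  then show ?thesis
    by (rule has_field_derivative_transform_within_open[where S="{0<..}"])
      (use greater in \<open>auto simp: flat_exp_def\<close>)
qed

text \<open>The derivative formula stays within the family, so the induction on \<open>m\<close>
  runs over all \<open>k\<close> at once. The bumps only use affine functions of one coordinate as
  arguments.\<close>

lemma Ck_flat_exp: "Ck m (\<lambda>x::real^'n. flat_exp k (c * x $ i + d))"
proof (induction m arbitrary: k)
  case 0
  have "isCont (flat_exp k) t" for t by (rule DERIV_isCont[OF DERIV_flat_exp])
  then have "continuous_on UNIV (flat_exp k)" by (simp add: continuous_at_imp_continuous_on)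
  then show ?case
    by (auto intro!: continuous_intros intro: continuous_on_compose2)
next
  case (Suc m)
  let ?g = "\<lambda>t. flat_exp (k + 2) t - of_nat k * flat_exp (k + 1) t"
  have D: "((\<lambda>x::real^'n. flat_exp k (c * x $ i + d)) has_derivative
      (\<lambda>h. ?g (c * x $ i + d) * (c * h $ i))) (at x)" for x
  proof -
    have "((\<lambda>x::real^'n. c * x $ i + d) has_derivative (\<lambda>h. c * h $ i)) (at x)"
      by (auto intro!: derivative_eq_intros bounded_linear.has_derivative[OF bounded_linear_vec_nth])
    from has_derivative_compose[OF this DERIV_flat_exp[THEN has_field_derivative_imp_has_derivative]]
    show ?thesis .
  qed
  have "pderiv_fun j (\<lambda>x::real^'n. flat_exp k (c * x $ i + d)) =
      (\<lambda>x. (flat_exp (k + 2) (c * x $ i + d) + (- of_nat k) * flat_exp (k + 1) (c * x $ i + d)) *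
           (c * axis j 1 $ i))" for j
    by (rule ext) (simp only: pderiv_fun_eq[OF D], simp add: algebra_simps)
  moreover have "Ck m (\<lambda>x. (flat_exp (k + 2) (c * x $ i + d) +
      (- of_nat k) * flat_exp (k + 1) (c * x $ i + d)) * (c * axis j 1 $ i))" for j
    by (intro Ck_mult Ck_add Ck_const Suc.IH)
  ultimately show ?case
    using D by (auto simp: differentiable_def)
qed

text \<open>Two factors \<open>exp (- 1 / t)\<close> for each coordinate, with \<open>t\<close> the
  distance to a face scaled by \<open>m + 1\<close>. As \<open>m\<close> grows every factor tends to
  1 inside the box, so the bumps approximate its indicator. Adding a negated constant fits the
  affine pattern of \<open>Ck_flat_exp\<close>.\<close>

definition box_bump :: "nat \<Rightarrow> real^'n \<Rightarrow> real^'n \<Rightarrow> real^'n \<Rightarrow> real"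
  where "box_bump m a b x = (\<Prod>i\<in>UNIV.
    flat_exp 0 (real (Suc m) * x $ i + - (real (Suc m) * a $ i)) *
    flat_exp 0 (- real (Suc m) * x $ i + real (Suc m) * b $ i))"

lemma flat_exp_0_bounds: "0 \<le> flat_exp 0 t" "flat_exp 0 t \<le> 1"
  by (auto simp: flat_exp_def)

lemma box_bump_bounds: "0 \<le> box_bump m a b x" "box_bump m a b x \<le> 1"
  unfolding box_bump_def
  by (auto intro!: prod_nonneg prod_le_1 mult_nonneg_nonneg mult_le_one flat_exp_0_bounds)

lemma box_bump_outside: 
  assumes "x \<notin> box a b"
  shows "box_bump m a b x = 0"
proof -
  obtain i where "x $ i \<le> a $ i \<or> b $ i \<le> x $ i"
    using assms by (auto simp: mem_box_cart not_less)
  then have "real (Suc m) * x $ i \<le> real (Suc m) * a $ i \<or> real (Suc m) * b $ i \<le> real (Suc m) * x $ i"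
    by (auto intro: mult_left_mono)
  then have "\<exists>i. flat_exp 0 (real (Suc m) * x $ i + - (real (Suc m) * a $ i)) *
    flat_exp 0 (- real (Suc m) * x $ i + real (Suc m) * b $ i) = 0"
    by (intro exI[of _ i]) (auto simp: flat_exp_def simp del: of_nat_Suc)
  then show ?thesis by (simp only: box_bump_def prod_zero_iff finite) blast
qed

lemma box_bump_tendsto: "(\<lambda>m. box_bump m a b x) \<longlonglongrightarrow> indicator (box a b) x"
proof (cases "x \<in> box a b")
  case False
  then show ?thesis by (simp add: box_bump_outside)
next
  case True
  have *: "(\<lambda>m. flat_exp 0 (real (Suc m) * s)) \<longlonglongrightarrow> 1" if "0 < s" for s
  proof -
    have "(\<lambda>m. exp (- (inverse (real (Suc m)) * inverse s))) \<longlonglongrightarrow> exp (- (0 * inverse s))"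
      by (intro tendsto_intros LIMSEQ_inverse_real_of_nat)
    with that show ?thesis by (simp add: flat_exp_def)
  qed
  have "(\<lambda>m. box_bump m a b x) \<longlonglongrightarrow> (\<Prod>i\<in>(UNIV::'a set). 1 * 1)"
    unfolding box_bump_def
  proof (intro tendsto_prod tendsto_mult)
    fix i
    show "(\<lambda>m. flat_exp 0 (real (Suc m) * x $ i + - (real (Suc m) * a $ i))) \<longlonglongrightarrow> 1"
      using *[of "x $ i - a $ i"] True by (simp add: mem_box_cart algebra_simps)
    show "(\<lambda>m. flat_exp 0 (- real (Suc m) * x $ i + real (Suc m) * b $ i)) \<longlonglongrightarrow> 1"
      using *[of "b $ i - x $ i"] True by (simp add: mem_box_cart algebra_simps)
  qed
  with True show ?thesis by simp
qed

lemma box_bump_test_function: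
  assumes "cbox a b \<subseteq> S"
  shows "box_bump m a b \<in> test_functions S"
proof -
  have "Ck k (box_bump m a b)" for k
    unfolding box_bump_def[abs_def] by (intro Ck_prod Ck_mult Ck_flat_exp) auto
  moreover have "{x. box_bump m a b x \<noteq> 0} \<subseteq> box a b"
    using box_bump_outside by blast
  then have "closure {x. box_bump m a b x \<noteq> 0} \<subseteq> cbox a b"
    by (meson box_subset_cbox closed_cbox closure_minimal order_trans)
  moreover from this have "compact (closure {x. box_bump m a b x \<noteq> 0})"
    by (meson bounded_cbox bounded_subset closed_closure compact_eq_bounded_closed)
  ultimately show ?thesis
    using assms by (auto simp: test_functions_def)
qed

text \<open>Boxes form an intersection-stable generator of the Borel sets, so a Dynkin argument
  spreads the vanishing to all Borel sets, among them those where \<open>D\<close> is positive or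
  negative.\<close>

lemma AE_zero_if_box_integrals_zero:
  fixes D :: "'a::euclidean_space \<Rightarrow> real"
  assumes int: "integrable lborel D"
    and box: "\<And>a b. (LINT x:box a b|lborel. D x) = 0"
  shows "AE x in lborel. D x = 0"
proof -
  have [measurable]: "D \<in> borel_measurable borel" using int by auto
  have si: "set_integrable lborel A D" if "A \<in> sets borel" for A
    unfolding set_integrable_def using integrable_mult_indicator[OF _ int] that by simp
  \<comment> \<open>The whole space is not a box, but the complement step below needs its integral;
    growing cubes exhaust it.\<close>
  have all: "(LINT x:UNIV|lborel. D x) = 0"
  proof -
    have "(\<lambda>n::nat. LINT x:box (- real n *\<^sub>R One) (real n *\<^sub>R One)|lborel. D x) \<longlonglongrightarrow> (LINT x:UNIV|lborel. D x)"
      unfolding set_lebesgue_integral_def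
    proof (rule integral_dominated_convergence[where w="\<lambda>x. norm (D x)"])
      show "AE x in lborel. (\<lambda>n::nat. indicat_real (box (- real n *\<^sub>R One) (real n *\<^sub>R One)) x *\<^sub>R D x)
          \<longlonglongrightarrow> indicat_real UNIV x *\<^sub>R D x"
      proof (rule AE_I2)
        fix x :: 'a
        obtain N :: nat where N: "norm x < real N" using reals_Archimedean2 by blast
        have "x \<in> box (- real n *\<^sub>R One) (real n *\<^sub>R One)" if "n \<ge> N" for n
        proof -
          have "\<bar>x \<bullet> i\<bar> < real n" if "i \<in> Basis" for i
            using Basis_le_norm[OF that, of x] N \<open>n \<ge> N\<close> by linarith
          then show ?thesis by (simp add: mem_box abs_less_iff minus_less_iff)
        qed
        then show "(\<lambda>n::nat. indicat_real (box (- real n *\<^sub>R One) (real n *\<^sub>R One)) x *\<^sub>R D x)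
          \<longlonglongrightarrow> indicat_real UNIV x *\<^sub>R D x"
          by (intro tendsto_eventually) (auto simp: eventually_sequentially intro!: exI[of _ N])
      qed
    qed (use int in \<open>auto simp: indicator_def\<close>)
    then show ?thesis unfolding box by (simp add: LIMSEQ_const_iff)
  qed
  have zero: "(LINT x:A|lborel. D x) = 0" if A: "A \<in> sets borel" for A
  proof -
    have "Int_stable (range (\<lambda>(a, b). box a b :: 'a set))"
      by (auto simp: Int_stable_def box_Int_box)
    moreover have "range (\<lambda>(a, b). box a b) \<subseteq> Pow (UNIV::'a set)" by auto
    moreover have "A \<in> sigma_sets UNIV (range (\<lambda>(a, b). box a b))"
      using A unfolding borel_eq_box by simp
    ultimately show ?thesis
    proof (induction rule: sigma_sets_induct_disjoint)
      case (basic A)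
      then show ?case using box by auto
    next
      case empty
      then show ?case by (simp add: set_lebesgue_integral_def)
    next
      case (compl A)
      then have A: "A \<in> sets borel" by (simp add: borel_eq_box)
      have "(LINT x:A \<union> (UNIV - A)|lborel. D x) =
          (LINT x:A|lborel. D x) + (LINT x:UNIV - A|lborel. D x)"
        using A by (intro set_integral_Un si) auto
      then show ?case using all compl by (simp add: Un_Diff_cancel)
    next
      case (union F)
      then have F: "F i \<in> sets borel" for i by (simp add: borel_eq_box subset_eq)
      have "(LINT x:(\<Union>i. F i)|lborel. D x) = (\<Sum>i. LINT x:F i|lborel. D x)"
        by (rule lebesgue_integral_countable_add)
          (use F union.hyps in \<open>auto intro!: si simp: disjoint_family_on_def\<close>)
      then show ?case using union by simp
    qed
  qed
  \<comment> \<open>The values \<open>s = 1\<close> and \<open>s = -1\<close> give the positive and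
    the negative part of \<open>D\<close>.\<close>
  have pos: "AE x in lborel. indicator {x. 0 < s * D x} x *\<^sub>R (s * D x) = 0" for s
  proof (subst integral_nonneg_eq_0_iff_AE[symmetric])
    have m: "{x. 0 < s * D x} \<in> sets borel" by measurable
    show "(LINT x|lborel. indicat_real {x. 0 < s * D x} x *\<^sub>R (s * D x)) = 0"
      using zero[OF m] by (simp add: set_lebesgue_integral_def mult.left_commute)
    show "integrable lborel (\<lambda>x. indicat_real {x. 0 < s * D x} x *\<^sub>R (s * D x))"
      using si[OF m] unfolding set_integrable_def
      by (simp add: mult.left_commute)
  qed (auto simp: indicator_def)
  from pos[of 1] pos[of "-1"] show ?thesis
  proof eventually_elim
    case (elim x)
    then show ?case by (cases "D x" "0::real" rule: linorder_cases) auto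
  qed
qed

section \<open>Closure properties, bounds and integrals of test functions\<close>

lemma test_function_pderiv:
  assumes "\<phi> \<in> test_functions S"
  shows "pderiv_fun j \<phi> \<in> test_functions S"
proof -
  define T where "T = closure {x. \<phi> x \<noteq> 0}"
  have \<phi>: "\<And>k. Ck k \<phi>" "compact T" "T \<subseteq> S"
    using assms by (auto simp: test_functions_def T_def)
  have out: "\<phi> y = 0" if "y \<in> - T" for y
    using that closure_subset[of "{x. \<phi> x \<noteq> 0}"] unfolding T_def by blast
  have op: "open (- T)" by (simp add: T_def open_Compl)
  \<comment> \<open>Differentiation does not enlarge the support: off the closed set
    \<open>T\<close> the function is locally zero.\<close>
  have "pderiv_fun j \<phi> x = 0" if "x \<notin> T" for x
  proof -
    have "(\<phi> has_derivative (\<lambda>h. 0)) (at x)"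
    proof (rule has_derivative_transform_within_open[OF has_derivative_const op])
      show "x \<in> - T" using that by simp
      show "0 = \<phi> y" if "y \<in> - T" for y using out[OF that] by simp
    qed
    from pderiv_fun_eq[OF this] show ?thesis by simp
  qed
  then have sub: "closure {x. pderiv_fun j \<phi> x \<noteq> 0} \<subseteq> T"
    by (intro closure_minimal) (auto simp: T_def)
  then have "compact (closure {x. pderiv_fun j \<phi> x \<noteq> 0})"
    by (metis \<phi>(2) closed_closure compact_Int_closed inf.absorb_iff2)
  moreover have "Ck k (pderiv_fun j \<phi>)" for k
    using \<phi>(1)[of "Suc k"] by simp
  ultimately show ?thesis using \<phi>(3) sub by (auto simp: test_functions_def)
qed

lemma test_function_mult:
  assumes "\<phi> \<in> test_functions S" "\<psi> \<in> test_functions S"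
  shows "(\<lambda>x. \<phi> x * \<psi> x) \<in> test_functions S"
proof -
  have *: "closure {x. \<phi> x * \<psi> x \<noteq> 0} \<subseteq> closure {x. \<phi> x \<noteq> 0}"
    by (intro closure_mono) auto
  have "compact (closure {x. \<phi> x * \<psi> x \<noteq> 0})"
  proof -
    have "bounded {x. \<phi> x \<noteq> 0}" using assms(1) by (simp add: test_functions_def)
    then have "bounded {x. \<phi> x * \<psi> x \<noteq> 0}" by (rule bounded_subset) auto
    then show ?thesis by (simp only: compact_closure)
  qed
  moreover have "closure {x. \<phi> x \<noteq> 0} \<subseteq> S" using assms(1) by (simp add: test_functions_def)
  moreover have "\<forall>k. Ck k (\<lambda>x. \<phi> x * \<psi> x)" using assms by (simp add: test_functions_def Ck_mult)
  ultimately show ?thesis unfolding test_functions_def using * by blast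
qed

lemma test_functions_mono: "S \<subseteq> T \<Longrightarrow> test_functions S \<subseteq> test_functions T"
  by (auto simp: test_functions_def)

lemma test_function_outside: "\<phi> \<in> test_functions S \<Longrightarrow> x \<notin> S \<Longrightarrow> \<phi> x = 0"
  using closure_subset[of "{x. \<phi> x \<noteq> 0}"] by (auto simp: test_functions_def)

lemma test_function_continuous: "\<phi> \<in> test_functions S \<Longrightarrow> continuous_on UNIV \<phi>"
  unfolding test_functions_def by (metis (no_types, lifting) Ck.simps(1) mem_Collect_eq)

lemma test_function_differentiable: "\<phi> \<in> test_functions S \<Longrightarrow> \<phi> differentiable at x"
  unfolding test_functions_def by (metis (no_types, lifting) Ck.simps(2) mem_Collect_eq)

lemma test_function_bounded:
  assumes "\<phi> \<in> test_functions S"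
  obtains B where "\<And>x. \<bar>\<phi> x\<bar> \<le> B" "0 \<le> B"
proof -
  let ?T = "closure {x. \<phi> x \<noteq> 0}"
  have "compact (\<phi> ` ?T)"
    using assms test_function_continuous[OF assms] continuous_on_subset
    by (intro compact_continuous_image) (auto simp: test_functions_def)
  then obtain B where B: "\<And>x. x \<in> ?T \<Longrightarrow> \<bar>\<phi> x\<bar> \<le> B"
    by (metis bounded_iff compact_imp_bounded imageI real_norm_def)
  have "\<bar>\<phi> x\<bar> \<le> max B 0" for x
    using B[of x] closure_subset[of "{x. \<phi> x \<noteq> 0}"] by (cases "\<phi> x = 0") fastforce+
  then show ?thesis by (intro that[of "max B 0"]) auto
qed

lemma test_function_measurable: "\<phi> \<in> test_functions S \<Longrightarrow> \<phi> \<in> borel_measurable M" if "sets M = sets borel"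
  using borel_measurable_continuous_onI[OF test_function_continuous] measurable_cong_sets[OF that refl] by blast

lemma test_function_measurable_lebesgue_on: "\<phi> \<in> test_functions S \<Longrightarrow> \<phi> \<in> borel_measurable (lebesgue_on T)"
  using borel_measurable_continuous_onI[OF test_function_continuous]
  by (metis measurable_completion measurable_lborel2 measurable_restrict_space1)

lemma integrable_mult_test_function:
  assumes "integrable (lebesgue_on T) h" "\<phi> \<in> test_functions S"
  shows "integrable (lebesgue_on T) (\<lambda>x. h x * \<phi> x)"
proof -
  obtain B where B: "\<And>x. \<bar>\<phi> x\<bar> \<le> B" "0 \<le> B" by (rule test_function_bounded[OF assms(2)]) blast
  note [measurable] = borel_measurable_integrable[OF assms(1)] test_function_measurable_lebesgue_on[OF assms(2)]
  show ?thesis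
  proof (rule Bochner_Integration.integrable_bound[OF integrable_mult_right[OF assms(1), of B]])
    show "AE x in lebesgue_on T. norm (h x * \<phi> x) \<le> norm (B * h x)"
      using B by (auto simp: abs_mult mult.commute[of B] intro!: mult_left_mono)
  qed measurable
qed

text \<open>Difference quotients along a coordinate have integral zero by translation invariance of
  Lebesgue measure, and dominated convergence passes to the derivative.\<close>

lemma integral_pderiv_test_function_lborel:
  fixes \<phi> :: "real^'n \<Rightarrow> real"
  assumes \<phi>: "\<phi> \<in> test_functions S"
  shows "(LINT x|lborel. pderiv_fun j \<phi> x) = 0"
proof -
  let ?T = "closure {x. \<phi> x \<noteq> 0}"
  define e :: "real^'n" where "e = axis j 1"
  have e: "norm e = 1" by (simp add: e_def)
  have "bounded ?T" using \<phi> by (auto simp: test_functions_def compact_imp_bounded)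
  then obtain R where R: "\<And>x. x \<in> ?T \<Longrightarrow> norm x \<le> R" by (auto simp: bounded_iff)
  have zero: "\<phi> x = 0" if "norm x > R" for x
    using R[of x] that closure_subset[of "{x. \<phi> x \<noteq> 0}"] by fastforce
  obtain B where B: "\<And>x. \<bar>pderiv_fun j \<phi> x\<bar> \<le> B" "0 \<le> B"
    by (rule test_function_bounded[OF test_function_pderiv[OF \<phi>]]) blast
  have line: "((\<lambda>t. \<phi> (x + t *\<^sub>R e)) has_real_derivative pderiv_fun j \<phi> (x + t *\<^sub>R e)) (at t)" for x t
  proof -
    have "((\<lambda>t. x + t *\<^sub>R e) has_derivative (\<lambda>h. h *\<^sub>R e)) (at t)"
      by (auto intro!: derivative_eq_intros)
    from has_derivative_compose[OF this test_function_differentiable[OF \<phi>, THEN frechet_derivative_works[THEN iffD1]]]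
    have "((\<lambda>t. \<phi> (x + t *\<^sub>R e)) has_derivative
        (\<lambda>h. frechet_derivative \<phi> (at (x + t *\<^sub>R e)) (h *\<^sub>R e))) (at t)" .
    moreover have "linear (frechet_derivative \<phi> (at (x + t *\<^sub>R e)))"
      by (rule linear_frechet_derivative[OF test_function_differentiable[OF \<phi>]])
    ultimately show ?thesis
      by (simp add: has_field_derivative_def pderiv_fun_def e_def linear_cmul mult_commute_abs)
  qed
  define F where "F n x = (\<phi> (x + inverse (real (Suc n)) *\<^sub>R e) - \<phi> x) / inverse (real (Suc n))" for n x
  have [measurable]: "\<phi> \<in> borel_measurable borel" "pderiv_fun j \<phi> \<in> borel_measurable borel"
    using test_function_measurable[OF _ \<phi>] test_function_measurable[OF _ test_function_pderiv[OF \<phi>]] by auto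
  have F_lim: "(\<lambda>n. F n x) \<longlonglongrightarrow> pderiv_fun j \<phi> x" for x
  proof -
    have "((\<lambda>h. (\<phi> (x + h *\<^sub>R e) - \<phi> x) / h) \<longlongrightarrow> pderiv_fun j \<phi> x) (at 0)"
      using line[of x 0] by (simp add: has_field_derivative_iff)
    moreover have "filterlim (\<lambda>n. inverse (real (Suc n))) (at 0) sequentially"
      using LIMSEQ_inverse_real_of_nat by (simp add: filterlim_at)
    ultimately show ?thesis unfolding F_def by (rule filterlim_compose)
  qed
  \<comment> \<open>Inside the larger ball the mean value theorem applies; the step is at most 1, so
    outside radius \<open>R + 1\<close> both values of \<phi> vanish.\<close>
  have F_bound: "\<bar>F n x\<bar> \<le> B * indicator (cball 0 (R + 1)) x" for n x
  proof -
    let ?h = "inverse (real (Suc n))"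
    have h: "0 < ?h" "?h \<le> 1" by (auto simp: inverse_le_1_iff)
    show ?thesis
    proof (cases "norm x \<le> R + 1")
      case True
      obtain z where "\<phi> (x + ?h *\<^sub>R e) - \<phi> (x + 0 *\<^sub>R e) = (?h - 0) * pderiv_fun j \<phi> (x + z *\<^sub>R e)"
        using MVT2[OF h(1), of "\<lambda>t. \<phi> (x + t *\<^sub>R e)" "\<lambda>t. pderiv_fun j \<phi> (x + t *\<^sub>R e)"] line by blast
      then have "F n x = pderiv_fun j \<phi> (x + z *\<^sub>R e)"
        by (simp add: F_def field_simps)
      then show ?thesis using B True by simp
    next
      case False
      have "norm x \<le> norm (x + ?h *\<^sub>R e) + norm (?h *\<^sub>R e)"
        using norm_triangle_ineq4[of "x + ?h *\<^sub>R e" "?h *\<^sub>R e"] by simp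
      then have "norm (x + ?h *\<^sub>R e) > R" using False h e by simp
      then show ?thesis using False zero[of x] zero[of "x + ?h *\<^sub>R e"] by (simp add: F_def)
    qed
  qed
  have dom: "integrable lborel (\<lambda>x::real^'n. B * indicator (cball 0 (R + 1)) x)"
    by (intro integrable_mult_right integrable_real_indicator emeasure_bounded_finite) auto
  have int: "integrable lborel \<phi>"
  proof -
    obtain C where C: "\<And>x. \<bar>\<phi> x\<bar> \<le> C" "0 \<le> C" by (rule test_function_bounded[OF \<phi>]) blast
    have "integrable lborel (\<lambda>x::real^'n. C * indicator (cball 0 R) x)"
      by (intro integrable_mult_right integrable_real_indicator emeasure_bounded_finite) auto
    then show ?thesis
    proof (rule Bochner_Integration.integrable_bound)
      show "AE x in lborel. norm (\<phi> x) \<le> norm (C * indicator (cball 0 R) x)"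
        using C zero by (auto simp: indicator_def abs_mult)
    qed measurable
  qed
  have F_int: "(LINT x|lborel. F n x) = 0" for n
  proof -
    let ?c = "inverse (real (Suc n)) *\<^sub>R e"
    have tr: "integrable lborel (\<lambda>x. \<phi> (?c + x))" "(LINT x|lborel. \<phi> (?c + x)) = (LINT x|lborel. \<phi> x)"
      using int integrable_distr_eq[of "(+) ?c" lborel borel \<phi>] integral_distr[of "(+) ?c" lborel borel \<phi>]
      by (simp_all add: lborel_distr_plus)
    then show ?thesis using int by (simp add: F_def add.commute)
  qed
  have "(\<lambda>n. LINT x|lborel. F n x) \<longlonglongrightarrow> (LINT x|lborel. pderiv_fun j \<phi> x)"
  proof (rule integral_dominated_convergence[OF _ _ dom])
    show "F n \<in> borel_measurable lborel" for n unfolding F_def by measurable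
  qed (use F_lim F_bound in auto)
  then show ?thesis by (simp add: F_int LIMSEQ_const_iff)
qed

lemma integral_lebesgue_on_subset:
  fixes g :: "'a::euclidean_space \<Rightarrow> real"
  assumes "S \<in> sets lebesgue" "T \<in> sets lebesgue" "S \<subseteq> T" "\<And>x. x \<in> T \<Longrightarrow> x \<notin> S \<Longrightarrow> g x = 0"
  shows "(LINT x|lebesgue_on T. g x) = (LINT x|lebesgue_on S. g x)"
proof -
  have "(LINT x|lebesgue_on T. g x) = (LINT x|lebesgue_on T. (if x \<in> S then g x else 0))"
    using assms(4) by (intro Bochner_Integration.integral_cong) auto
  also have "\<dots> = (LINT x|lebesgue_on S. g x)"
    using assms by (intro Lebesgue_Measure.integral_restrict) auto
  finally show ?thesis .
qed

lemma integral_pderiv_test_function: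
  assumes "\<phi> \<in> test_functions S" "S \<in> sets lebesgue"
  shows "(LINT x|lebesgue_on S. pderiv_fun j \<phi> x) = 0"
proof -
  note p = test_function_pderiv[OF assms(1)]
  have "(LINT x|lebesgue_on UNIV. pderiv_fun j \<phi> x) = (LINT x|lebesgue_on S. pderiv_fun j \<phi> x)"
    using test_function_outside[OF p] by (intro integral_lebesgue_on_subset assms) auto
  moreover have "(LINT x|lebesgue. pderiv_fun j \<phi> x) = (LINT x|lborel. pderiv_fun j \<phi> x)"
    using test_function_measurable[OF _ p] by (intro integral_completion) auto
  ultimately show ?thesis
    using integral_pderiv_test_function_lborel[OF assms(1)] by (simp add: lebesgue_on_UNIV_eq)
qed

text \<open>Bumps turn the hypothesis into vanishing integrals over boxes whose closure lies in
  \<open>S\<close>; the box criterion then works on each closed cell of a countable cover of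
  \<open>S\<close>.\<close>

lemma fundamental_lemma_variations:
  fixes h :: "real^'n \<Rightarrow> real"
  assumes S: "open S" and int: "integrable (lebesgue_on S) h"
    and zero: "\<And>\<phi>. \<phi> \<in> test_functions S \<Longrightarrow> (LINT x|lebesgue_on S. h x * \<phi> x) = 0"
  shows "AE x in lebesgue_on S. h x = 0"
proof -
  have [measurable]: "h \<in> borel_measurable (lebesgue_on S)" using int by auto
  have Sm: "S \<in> sets lebesgue" using S by auto
  have box: "(LINT x|lebesgue_on S. h x * indicator (box a b) x) = 0" if "cbox a b \<subseteq> S" for a b
  proof -
    note t = box_bump_test_function[OF that]
    have "(\<lambda>m. LINT x|lebesgue_on S. h x * box_bump m a b x) \<longlonglongrightarrow>
        (LINT x|lebesgue_on S. h x * indicator (box a b) x)"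
    proof (rule integral_dominated_convergence[where w="\<lambda>x. \<bar>h x\<bar>"])
      have [measurable]: "box a b \<in> sets (lebesgue_on S)"
        using that box_subset_cbox[of a b] by (simp add: sets_restrict_space_iff Sm)
      show "(\<lambda>x. h x * indicator (box a b) x) \<in> borel_measurable (lebesgue_on S)" by measurable
      show "(\<lambda>x. h x * box_bump m a b x) \<in> borel_measurable (lebesgue_on S)" for m
        by (rule borel_measurable_integrable[OF integrable_mult_test_function[OF int t]])
      show "AE x in lebesgue_on S. norm (h x * box_bump m a b x) \<le> \<bar>h x\<bar>" for m
        using box_bump_bounds[of m a b] by (auto simp: abs_mult intro!: mult_left_le)
      show "AE x in lebesgue_on S. (\<lambda>m. h x * box_bump m a b x) \<longlonglongrightarrow> h x * indicator (box a b) x"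
        by (intro AE_I2 tendsto_mult_left box_bump_tendsto)
    qed (use int in simp)
    then show ?thesis using zero[OF t] by (simp add: LIMSEQ_const_iff)
  qed
  \<comment> \<open>\<open>D0\<close> is only Lebesgue measurable, while the box criterion concerns
    \<open>lborel\<close>; a Borel version \<open>D\<close> takes its place.\<close>
  define D0 where "D0 x = (if x \<in> S then h x else 0)" for x
  have D0: "integrable lebesgue D0"
    unfolding D0_def using int Sm by (simp add: Lebesgue_Measure.integrable_restrict_UNIV)
  then obtain D where D[measurable]: "D \<in> borel_measurable lborel" and AE_D: "AE x in lborel. D0 x = D x"
    using completion_ex_borel_measurable_real[OF borel_measurable_integrable] by blast
  have AE_D': "AE x in lebesgue. D0 x = D x" by (rule AE_completion[OF AE_D])
  have intD: "integrable lborel D"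
  proof -
    have "integrable lebesgue D"
      using D0 AE_D' D by (subst integrable_cong_AE[symmetric, of D0]) (auto intro: measurable_completion)
    then show ?thesis using D by (simp add: integrable_completion)
  qed
  \<comment> \<open>The box criterion quantifies over all boxes of the space. Multiplying by the
    indicator of \<open>box a b\<close> reduces each of them to a box with closure in
    \<open>S\<close>.\<close>
  have cell: "AE x in lborel. x \<in> cbox a b \<longrightarrow> D x = 0" if ab: "cbox a b \<subseteq> S" for a b
  proof -
    have "AE x in lborel. indicator (box a b) x * D x = 0"
    proof (rule AE_zero_if_box_integrals_zero)
      show "integrable lborel (\<lambda>x. indicat_real (box a b) x * D x)"
        using integrable_mult_indicator[OF _ intD, of "box a b"] by simp
      fix c d
      obtain a' b' where ab': "box c d \<inter> box a b = box a' b'" "cbox c d \<inter> cbox a b = cbox a' b'"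
        by (rule that[OF box_Int_box Int_interval])
      have sub: "cbox a' b' \<subseteq> S" using ab ab' by blast
      have "(LINT x:box c d|lborel. indicat_real (box a b) x * D x)
          = (LINT x|lborel. indicat_real (box a' b') x * D x)"
        unfolding ab'(1)[symmetric] set_lebesgue_integral_def
        by (intro Bochner_Integration.integral_cong) (auto simp: indicator_def)
      also have "\<dots> = (LINT x|lebesgue. indicat_real (box a' b') x * D x)"
        by (intro integral_completion[symmetric]) measurable
      also have "\<dots> = (LINT x|lebesgue. indicat_real (box a' b') x * D0 x)"
      proof (rule integral_cong_AE)
        show "(\<lambda>x. indicat_real (box a' b') x * D x) \<in> borel_measurable lebesgue"
          by (intro measurable_completion) measurable
        show "(\<lambda>x. indicat_real (box a' b') x * D0 x) \<in> borel_measurable lebesgue"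
          using borel_measurable_integrable[OF integrable_mult_indicator[OF _ D0, of "box a' b'"]] by simp
        show "AE x in lebesgue. indicat_real (box a' b') x * D x = indicat_real (box a' b') x * D0 x"
          using AE_D' by eventually_elim simp
      qed
      also have "\<dots> = (LINT x|lebesgue. (if x \<in> S then h x * indicator (box a' b') x else 0))"
        by (intro Bochner_Integration.integral_cong) (auto simp: D0_def)
      also have "\<dots> = (LINT x|lebesgue_on S. h x * indicator (box a' b') x)"
        by (rule Lebesgue_Measure.integral_restrict_UNIV[OF Sm])
      also have "\<dots> = 0" by (rule box[OF sub])
      finally show "(LINT x:box c d|lborel. indicat_real (box a b) x * D x) = 0" .
    qed
    \<comment> \<open>The cover below consists of closed cells, which differ from open boxes by a
      null set.\<close>
    moreover have "AE x in lborel. x \<notin> cbox a b - box a b"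
      using negligible_frontier_interval[of a b] by (metis AE_completion_iff AE_not_in negligible_iff_null_sets)
    ultimately show ?thesis
      by eventually_elim (auto simp: indicator_def split: if_splits)
  qed
  obtain \<D> where \<D>: "countable \<D>" "\<D> \<subseteq> Pow S" "\<And>X. X \<in> \<D> \<Longrightarrow> \<exists>a b. X = cbox a b" "\<Union>\<D> = S"
    using open_countable_Union_open_cbox[OF S] by metis
  have "AE x in lborel. \<forall>X\<in>\<D>. x \<in> X \<longrightarrow> D x = 0"
    using \<D>(1)
  proof (rule AE_ball_countable[THEN iffD2], intro ballI)
    fix X assume "X \<in> \<D>"
    then show "AE x in lborel. x \<in> X \<longrightarrow> D x = 0"
      using \<D>(2,3) cell by (metis PowD subsetD)
  qed
  with AE_D have "AE x in lborel. x \<in> S \<longrightarrow> h x = 0"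
  proof eventually_elim
    case (elim x)
    then show ?case using \<D>(4) unfolding D0_def by (metis UnionE)
  qed
  then have "AE x in lebesgue. x \<in> S \<longrightarrow> h x = 0" by (rule AE_completion)
  then show ?thesis using Sm by (simp add: AE_restrict_space_iff)
qed

section \<open>Square integrable functions\<close>

lemma L2_measurable: "f \<in> L2 S \<Longrightarrow> f \<in> borel_measurable (lebesgue_on S)"
  by (simp add: L2_def)

lemma L2_integrable_norm_power2: "f \<in> L2 S \<Longrightarrow> integrable (lebesgue_on S) (\<lambda>x. (norm (f x))\<^sup>2)"
  by (simp add: L2_def)

lemma L2_integrable_norm_mult:
  assumes "f \<in> L2 S" "g \<in> L2 S"
  shows "integrable (lebesgue_on S) (\<lambda>x. norm (f x) * norm (g x))"
proof -
  note [measurable] = assms[THEN L2_measurable]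
  have "integrable (lebesgue_on S) (\<lambda>x. (norm (f x))\<^sup>2 + (norm (g x))\<^sup>2)"
    using assms[THEN L2_integrable_norm_power2] by simp
  then show ?thesis
  proof (rule Bochner_Integration.integrable_bound)
    have "norm (f x) * norm (g x) \<le> (norm (f x))\<^sup>2 + (norm (g x))\<^sup>2" for x
      using sum_squares_bound[of "norm (f x)" "norm (g x)"] mult_nonneg_nonneg[OF norm_ge_zero[of "f x"] norm_ge_zero[of "g x"]] by linarith
    then show "AE x in lebesgue_on S. norm (norm (f x) * norm (g x)) \<le> norm ((norm (f x))\<^sup>2 + (norm (g x))\<^sup>2)"
      by auto
  qed measurable
qed

lemma L2_integrable_inner:
  assumes "f \<in> L2 S" "g \<in> L2 S"
  shows "integrable (lebesgue_on S) (\<lambda>x. f x \<bullet> g x)"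
proof -
  note [measurable] = assms[THEN L2_measurable]
  show ?thesis
    by (rule Bochner_Integration.integrable_bound[OF L2_integrable_norm_mult[OF assms]])
      (auto simp: Cauchy_Schwarz_ineq2)
qed

lemma L2_add:
  assumes "f \<in> L2 S" "g \<in> L2 S"
  shows "(\<lambda>x. f x + g x) \<in> L2 S"
proof -
  note [measurable] = assms[THEN L2_measurable]
  have "integrable (lebesgue_on S) (\<lambda>x. (norm (f x))\<^sup>2 + 2 * (norm (f x) * norm (g x)) + (norm (g x))\<^sup>2)"
    using assms[THEN L2_integrable_norm_power2] L2_integrable_norm_mult[OF assms] by simp
  then have "integrable (lebesgue_on S) (\<lambda>x. (norm (f x + g x))\<^sup>2)"
  proof (rule Bochner_Integration.integrable_bound)
    have "(norm (f x + g x))\<^sup>2 \<le> (norm (f x))\<^sup>2 + 2 * (norm (f x) * norm (g x)) + (norm (g x))\<^sup>2" for x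
      using power_mono[OF norm_triangle_ineq[of "f x" "g x"], of 2] by (simp add: power2_sum)
    then show "AE x in lebesgue_on S. norm ((norm (f x + g x))\<^sup>2)
       \<le> norm ((norm (f x))\<^sup>2 + 2 * (norm (f x) * norm (g x)) + (norm (g x))\<^sup>2)"
      by auto
  qed measurable
  then show ?thesis by (simp add: L2_def)
qed

lemma L2_scaleR: "f \<in> L2 S \<Longrightarrow> (\<lambda>x. c *\<^sub>R f x) \<in> L2 S"
  by (auto simp: L2_def power_mult_distrib)

lemma L2_diff: "f \<in> L2 S \<Longrightarrow> g \<in> L2 S \<Longrightarrow> (\<lambda>x. f x - g x) \<in> L2 S"
  using L2_add[of f S "\<lambda>x. (-1) *\<^sub>R g x"] L2_scaleR[of g S "-1"] by simp

lemma L2_zero: "(\<lambda>x. 0) \<in> L2 S"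
  by (simp add: L2_def)

lemma finite_measure_lebesgue_on_bounded:
  assumes "bounded S" "open S"
  shows "finite_measure (lebesgue_on S)"
  using assms emeasure_bounded_finite[OF assms(1)]
  by (intro finite_measureI) (auto simp: emeasure_restrict_space)

lemma L2_continuous:
  fixes f :: "real^'n \<Rightarrow> 'b::euclidean_space"
  assumes "continuous_on UNIV f" "bounded S" "open S"
  shows "f \<in> L2 S"
proof -
  interpret finite_measure "lebesgue_on S" by (rule finite_measure_lebesgue_on_bounded[OF assms(2,3)])
  have [measurable]: "f \<in> borel_measurable (lebesgue_on S)"
    using assms by (intro continuous_imp_measurable_on_sets_lebesgue) (auto intro: continuous_on_subset)
  have "compact (f ` closure S)"
    using assms by (intro compact_continuous_image) (auto intro: continuous_on_subset simp: compact_closure)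
  then obtain B where B: "\<And>x. x \<in> closure S \<Longrightarrow> norm (f x) \<le> B"
    by (metis bounded_iff compact_imp_bounded imageI)
  have "(norm (f x))\<^sup>2 \<le> B\<^sup>2" if "x \<in> S" for x
    using B that closure_subset by (intro power_mono) auto
  then have "integrable (lebesgue_on S) (\<lambda>x. (norm (f x))\<^sup>2)"
    by (intro integrable_const_bound[of _ "B\<^sup>2"]) auto
  then show ?thesis by (simp add: L2_def)
qed

lemma L2_const: "bounded S \<Longrightarrow> open S \<Longrightarrow> (\<lambda>x. c) \<in> L2 S"
  by (rule L2_continuous) auto

lemma L2_integrable_component:
  assumes "f \<in> L2 S" "bounded S" "open S"
  shows "integrable (lebesgue_on S) (\<lambda>x. f x \<bullet> c)"
  by (rule L2_integrable_inner[OF assms(1) L2_const[OF assms(2,3)]])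

lemma AE_lebesgue_on_subset:
  assumes "AE x in lebesgue_on T. R x" "S \<subseteq> T" "S \<in> sets lebesgue" "T \<in> sets lebesgue"
  shows "AE x in lebesgue_on S. R x"
proof -
  have "AE x in lebesgue. x \<in> T \<longrightarrow> R x" using assms by (simp add: AE_restrict_space_iff)
  then have "AE x in lebesgue. x \<in> S \<longrightarrow> R x" by eventually_elim (use assms(2) in auto)
  then show ?thesis using assms by (simp add: AE_restrict_space_iff)
qed

lemma integrable_lebesgue_on_subset:
  fixes f :: "'a::euclidean_space \<Rightarrow> real"
  assumes "integrable (lebesgue_on T) f" "S \<subseteq> T" "S \<in> sets lebesgue" "T \<in> sets lebesgue"
  shows "integrable (lebesgue_on S) f"
proof -
  have "set_integrable lebesgue T f" using assms by (simp add: set_integrable_def integrable_restrict_space)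
  then have "set_integrable lebesgue S f" by (rule set_integrable_subset) (use assms in auto)
  then show ?thesis using assms by (simp add: set_integrable_def integrable_restrict_space)
qed

lemma L2_subset: "f \<in> L2 T \<Longrightarrow> S \<subseteq> T \<Longrightarrow> open S \<Longrightarrow> open T \<Longrightarrow> f \<in> L2 S"
  unfolding L2_def
  by (auto intro: measurable_restrict_mono integrable_lebesgue_on_subset)

lemma l2_inner_commute: "l2_inner S f g = l2_inner S g f"
  by (simp add: l2_inner_def inner_commute)

lemma l2_inner_cong_AE:
  fixes f f' g g' :: "real^'n \<Rightarrow> 'b::euclidean_space"
  assumes "f \<in> L2 S" "g \<in> L2 S" "f' \<in> L2 S" "g' \<in> L2 S"
    "AE x in lebesgue_on S. f x = f' x" "AE x in lebesgue_on S. g x = g' x"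
  shows "l2_inner S f g = l2_inner S f' g'"
  unfolding l2_inner_def
proof (rule integral_cong_AE)
  show "AE x in lebesgue_on S. f x \<bullet> g x = f' x \<bullet> g' x"
    using assms(5,6) by eventually_elim simp
qed (auto intro: borel_measurable_integrable L2_integrable_inner assms)

lemma l2_inner_add_scaleR_left:
  assumes "f \<in> L2 S" "f' \<in> L2 S" "g \<in> L2 S"
  shows "l2_inner S (\<lambda>x. f x + c *\<^sub>R f' x) g = l2_inner S f g + c * l2_inner S f' g"
  using L2_integrable_inner[OF assms(1,3)] L2_integrable_inner[OF assms(2,3)]
  by (simp add: l2_inner_def inner_add_left)

lemma l2_inner_diff_right:
  assumes "f \<in> L2 S" "g \<in> L2 S" "g' \<in> L2 S"
  shows "l2_inner S f (\<lambda>x. g x - g' x) = l2_inner S f g - l2_inner S f g'"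
  using L2_integrable_inner[OF assms(1,2)] L2_integrable_inner[OF assms(1,3)]
  by (simp add: l2_inner_def inner_diff_right)

lemma l2_inner_AE_zero: "AE x in lebesgue_on S. f x = 0 \<Longrightarrow> l2_inner S f g = 0"
  unfolding l2_inner_def by (rule integral_eq_zero_AE) (auto elim: eventually_mono)

lemma l2_inner_self_nonneg: "0 \<le> l2_inner S f f"
  by (simp add: l2_inner_def)

lemma l2_inner_Cauchy_Schwarz:
  assumes "f \<in> L2 S" "g \<in> L2 S"
  shows "(l2_inner S f g)\<^sup>2 \<le> l2_inner S f f * l2_inner S g g"
proof (cases "l2_inner S f f = 0")
  case True
  then have "AE x in lebesgue_on S. f x \<bullet> f x = 0"
    unfolding l2_inner_def by (subst (asm) integral_nonneg_eq_0_iff_AE) (auto intro: L2_integrable_inner assms)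
  then have "AE x in lebesgue_on S. f x = 0" by simp
  then show ?thesis using True by (simp add: l2_inner_AE_zero)
next
  case False
  define a b c where "a = l2_inner S g g" and "b = l2_inner S f f" and "c = l2_inner S f g"
  have b: "0 < b" using False l2_inner_self_nonneg[of S f] by (simp add: b_def)
  \<comment> \<open>\<open>?h\<close> is \<open>b\<close> times the part of \<open>g\<close>
    orthogonal to \<open>f\<close>; its squared norm is \<open>b (b a - c^2)\<close>.\<close>
  let ?h = "\<lambda>x. b *\<^sub>R g x - c *\<^sub>R f x"
  have "0 \<le> l2_inner S ?h ?h" by (rule l2_inner_self_nonneg)
  also have "l2_inner S ?h ?h = (LINT x|lebesgue_on S. b\<^sup>2 * (g x \<bullet> g x) - 2 * b * c * (f x \<bullet> g x) + c\<^sup>2 * (f x \<bullet> f x))"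
    unfolding l2_inner_def
    by (intro Bochner_Integration.integral_cong)
      (auto simp: inner_diff_left inner_diff_right inner_commute power2_eq_square algebra_simps)
  also have "\<dots> = b\<^sup>2 * a - 2 * b * c * c + c\<^sup>2 * b"
    using L2_integrable_inner[OF assms] L2_integrable_inner[OF assms(1,1)] L2_integrable_inner[OF assms(2,2)]
    by (simp add: a_def b_def c_def l2_inner_def)
  also have "\<dots> = b * (b * a - c\<^sup>2)" by (simp add: power2_eq_square algebra_simps)
  finally show ?thesis using b by (simp add: zero_le_mult_iff a_def b_def c_def)
qed

text \<open>Measurability of \<open>g\<close> comes from completeness of Lebesgue measure: removing
  a null set from the domain does not affect it.\<close>

lemma L2_cong_AE:
  assumes f: "f \<in> L2 S" and eq: "AE x in lebesgue_on S. f x = g x" and S: "S \<in> sets lebesgue"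
  shows "g \<in> L2 S"
proof -
  obtain N where N: "\<And>x. x \<in> S - N \<Longrightarrow> f x = g x" "N \<in> null_sets (lebesgue_on S)"
    using AE_E3[OF eq] by auto
  have "f \<in> borel_measurable (lebesgue_on (S - N))"
    using L2_measurable[OF f] borel_measurable_diff_null[OF N(2) S] by blast
  then have "g \<in> borel_measurable (lebesgue_on (S - N))"
    using N(1) measurable_lebesgue_cong[of "S - N" f g borel] by blast
  then have [measurable]: "g \<in> borel_measurable (lebesgue_on S)"
    using borel_measurable_diff_null[OF N(2) S] by blast
  have "integrable (lebesgue_on S) (\<lambda>x. (norm (g x))\<^sup>2)"
  proof (rule Bochner_Integration.integrable_bound[OF L2_integrable_norm_power2[OF f]])
    show "AE x in lebesgue_on S. norm ((norm (g x))\<^sup>2) \<le> norm ((norm (f x))\<^sup>2)"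
      using eq by eventually_elim simp
  qed measurable
  then show ?thesis by (simp add: L2_def)
qed

lemma L2_bound:
  fixes g :: "real^'n \<Rightarrow> 'b::euclidean_space" and f :: "real^'n \<Rightarrow> 'c::euclidean_space"
  assumes g: "g \<in> L2 S" and f[measurable]: "f \<in> borel_measurable (lebesgue_on S)"
    and le: "AE x in lebesgue_on S. norm (f x) \<le> c * norm (g x)"
  shows "f \<in> L2 S"
proof -
  have "integrable (lebesgue_on S) (\<lambda>x. (norm (f x))\<^sup>2)"
  proof (rule Bochner_Integration.integrable_bound[OF integrable_mult_right[OF L2_integrable_norm_power2[OF g], of "c\<^sup>2"]])
    show "AE x in lebesgue_on S. norm ((norm (f x))\<^sup>2) \<le> norm (c\<^sup>2 * (norm (g x))\<^sup>2)"
      using le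
    proof eventually_elim
      case (elim x)
      then have "(norm (f x))\<^sup>2 \<le> (c * norm (g x))\<^sup>2" by (intro power_mono) auto
      then show ?case by (simp add: power_mult_distrib)
    qed
  qed measurable
  then show ?thesis by (simp add: L2_def)
qed

lemma L2_sum:
  assumes "finite I" "\<And>i. i \<in> I \<Longrightarrow> f i \<in> L2 S"
  shows "(\<lambda>x. \<Sum>i\<in>I. f i x) \<in> L2 S"
  using assms by (induction rule: finite_induct) (auto intro: L2_zero L2_add)

section \<open>Weak derivatives\<close>

text \<open>Each component of \<open>d - d'\<close> integrates to zero against every test function.
  Boundedness of \<open>S\<close> makes square integrable functions integrable, as the fundamental
  lemma requires.\<close>

lemma weak_div_unique:
  assumes S: "open S" "bounded S" and "d \<in> L2 S" "d' \<in> L2 S" "is_weak_div S \<tau> d" "is_weak_div S \<tau> d'"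
  shows "AE x in lebesgue_on S. d x = d' x"
proof -
  have int: "integrable (lebesgue_on S) (\<lambda>x. d x $ i)" "integrable (lebesgue_on S) (\<lambda>x. d' x $ i)" for i
    using L2_integrable_component[OF assms(3) S(2,1), of "axis i 1"]
      L2_integrable_component[OF assms(4) S(2,1), of "axis i 1"] by (auto simp: inner_axis)
  have "AE x in lebesgue_on S. d x $ i - d' x $ i = 0" for i
  proof (rule fundamental_lemma_variations[OF S(1)])
    show "integrable (lebesgue_on S) (\<lambda>x. d x $ i - d' x $ i)" using int by simp
    fix \<phi> assume \<phi>: "\<phi> \<in> test_functions S"
    then show "(LINT x|lebesgue_on S. (d x $ i - d' x $ i) * \<phi> x) = 0"
      using assms(5,6)[unfolded is_weak_div_def, rule_format, OF \<phi>, of i]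
        int[THEN integrable_mult_test_function, OF \<phi>]
      by (simp add: left_diff_distrib)
  qed
  then have "AE x in lebesgue_on S. \<forall>i\<in>UNIV. d x $ i - d' x $ i = 0"
    by (intro AE_finite_allI) auto
  then show ?thesis by eventually_elim (simp add: vec_eq_iff)
qed

lemma weak_grad_unique:
  assumes S: "open S" "bounded S" and "G \<in> L2 S" "G' \<in> L2 S" "is_weak_grad S v G" "is_weak_grad S v G'"
  shows "AE x in lebesgue_on S. G x = G' x"
proof -
  have int: "integrable (lebesgue_on S) (\<lambda>x. G x $ i $ j)" "integrable (lebesgue_on S) (\<lambda>x. G' x $ i $ j)" for i j
    using L2_integrable_component[OF assms(3) S(2,1), of "axis i (axis j 1)"]
      L2_integrable_component[OF assms(4) S(2,1), of "axis i (axis j 1)"] by (auto simp: inner_axis)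
  have "AE x in lebesgue_on S. G x $ i $ j - G' x $ i $ j = 0" for i j
  proof (rule fundamental_lemma_variations[OF S(1)])
    show "integrable (lebesgue_on S) (\<lambda>x. G x $ i $ j - G' x $ i $ j)" using int by simp
    fix \<phi> assume \<phi>: "\<phi> \<in> test_functions S"
    then show "(LINT x|lebesgue_on S. (G x $ i $ j - G' x $ i $ j) * \<phi> x) = 0"
      using assms(5,6)[unfolded is_weak_grad_def, rule_format, OF \<phi>, of i j]
        int[THEN integrable_mult_test_function, OF \<phi>]
      by (simp add: left_diff_distrib)
  qed
  then have "AE x in lebesgue_on S. \<forall>i\<in>UNIV. \<forall>j\<in>UNIV. G x $ i $ j - G' x $ i $ j = 0"
    by (intro AE_finite_allI) auto
  then show ?thesis by eventually_elim (simp add: vec_eq_iff)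
qed

lemma wgrad_properties:
  assumes "v \<in> H1 S"
  shows "wgrad S v \<in> L2 S" "is_weak_grad S v (wgrad S v)"
proof -
  have "\<exists>G. G \<in> L2 S \<and> is_weak_grad S v G" using assms by (auto simp: H1_def)
  from someI_ex[OF this] show "wgrad S v \<in> L2 S" "is_weak_grad S v (wgrad S v)"
    by (auto simp: wgrad_def)
qed

lemma wdiv_properties:
  assumes "\<tau> \<in> Hdiv S"
  shows "wdiv S \<tau> \<in> L2 S" "is_weak_div S \<tau> (wdiv S \<tau>)"
proof -
  have "\<exists>d. d \<in> L2 S \<and> is_weak_div S \<tau> d" using assms by (auto simp: Hdiv_def)
  from someI_ex[OF this] show "wdiv S \<tau> \<in> L2 S" "is_weak_div S \<tau> (wdiv S \<tau>)"
    by (auto simp: wdiv_def)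
qed

text \<open>The way into every computation of \<open>wgrad\<close>: the representative picked by
  \<open>SOME\<close> is known only through its defining property, so any exhibited weak gradient
  determines it almost everywhere.\<close>

lemma wgrad_AE_eq:
  assumes "open S" "bounded S" "v \<in> L2 S" "G \<in> L2 S" "is_weak_grad S v G"
  shows "v \<in> H1 S" "AE x in lebesgue_on S. wgrad S v x = G x"
proof -
  show v: "v \<in> H1 S" using assms by (auto simp: H1_def)
  show "AE x in lebesgue_on S. wgrad S v x = G x"
    using weak_grad_unique[OF assms(1,2) wgrad_properties(1)[OF v] assms(4) wgrad_properties(2)[OF v] assms(5)] .
qed

lemma wdiv_AE_eq:
  assumes "open S" "bounded S" "\<tau> \<in> L2 S" "d \<in> L2 S" "is_weak_div S \<tau> d"
  shows "\<tau> \<in> Hdiv S" "AE x in lebesgue_on S. wdiv S \<tau> x = d x"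
proof -
  show v: "\<tau> \<in> Hdiv S" using assms by (auto simp: Hdiv_def)
  show "AE x in lebesgue_on S. wdiv S \<tau> x = d x"
    using weak_div_unique[OF assms(1,2) wdiv_properties(1)[OF v] assms(4) wdiv_properties(2)[OF v] assms(5)] .
qed

lemma wdiv_const:
  fixes c :: "real^'n^'n"
  assumes "open S" "bounded S"
  shows "(\<lambda>x. c) \<in> Hdiv S" "AE x in lebesgue_on S. wdiv S (\<lambda>x. c) x = 0"
proof -
  have "is_weak_div S (\<lambda>x. c) (\<lambda>x. 0)"
    unfolding is_weak_div_def
  proof (intro ballI allI)
    fix \<phi> i assume \<phi>: "\<phi> \<in> test_functions S"
    have "integrable (lebesgue_on S) (\<lambda>x. 1 * pderiv_fun j \<phi> x)" for j
      using assms L2_integrable_component[OF L2_const[OF assms(2,1)], of "1::real" 1]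
      by (intro integrable_mult_test_function[OF _ test_function_pderiv[OF \<phi>]]) simp
    then show "(LINT x|lebesgue_on S. (\<Sum>j\<in>UNIV. c $ i $ j * pderiv_fun j \<phi> x)) =
          - (LINT x|lebesgue_on S. (0::real^'n) $ i * \<phi> x)"
      using integral_pderiv_test_function[OF \<phi>] assms(1) by (subst Bochner_Integration.integral_sum) auto
  qed
  from wdiv_AE_eq[OF assms L2_const[OF assms(2,1)] L2_zero this]
  show "(\<lambda>x. c) \<in> Hdiv S" "AE x in lebesgue_on S. wdiv S (\<lambda>x. c) x = 0" by auto
qed

lemma wgrad_zero:
  assumes "open S" "bounded S"
  shows "0 \<in> H1 S" "AE x in lebesgue_on S. wgrad S 0 x = 0"
proof -
  have "is_weak_grad S 0 (\<lambda>x. 0)" by (simp add: is_weak_grad_def)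
  from wgrad_AE_eq[OF assms _ L2_zero this] L2_zero[of S]
  show "0 \<in> H1 S" "AE x in lebesgue_on S. wgrad S 0 x = 0" by (auto simp: zero_fun_def)
qed

lemma is_weak_grad_diff:
  fixes v w :: "real^'n \<Rightarrow> real^'n"
  assumes S: "open S" "bounded S" and L: "v \<in> L2 S" "w \<in> L2 S" "G \<in> L2 S" "H \<in> L2 S"
    and "is_weak_grad S v G" "is_weak_grad S w H"
  shows "is_weak_grad S (v - w) (\<lambda>x. G x - H x)"
  unfolding is_weak_grad_def
proof (intro ballI allI)
  fix \<phi> and i j :: 'n assume \<phi>: "\<phi> \<in> test_functions S"
  have i1: "integrable (lebesgue_on S) (\<lambda>x. u x $ i * pderiv_fun j \<phi> x)" if "u \<in> L2 S" for u :: "real^'n \<Rightarrow> real^'n"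
    using integrable_mult_test_function[OF L2_integrable_component[OF that S(2,1), of "axis i 1"]
        test_function_pderiv[OF \<phi>]] by (simp add: inner_axis)
  have i2: "integrable (lebesgue_on S) (\<lambda>x. u x $ i $ j * \<phi> x)" if "u \<in> L2 S" for u :: "real^'n \<Rightarrow> real^'n^'n"
    using integrable_mult_test_function[OF L2_integrable_component[OF that S(2,1), of "axis i (axis j 1)"] \<phi>]
    by (simp add: inner_axis)
  show "(LINT x|lebesgue_on S. (v - w) x $ i * pderiv_fun j \<phi> x) =
      - (LINT x|lebesgue_on S. (G x - H x) $ i $ j * \<phi> x)"
    using assms(7,8)[unfolded is_weak_grad_def, rule_format, OF \<phi>, of i j] L(1,2)[THEN i1] L(3,4)[THEN i2]
    by (simp add: left_diff_distrib)
qed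

lemma wgrad_diff:
  assumes S: "open S" "bounded S" and H: "v \<in> H1 S" "w \<in> H1 S"
  shows "v - w \<in> H1 S" "AE x in lebesgue_on S. wgrad S (v - w) x = wgrad S v x - wgrad S w x"
proof -
  have L: "v \<in> L2 S" "w \<in> L2 S" using H by (auto simp: H1_def)
  then have "v - w \<in> L2 S" using L2_diff[OF L] by (simp add: fun_diff_def)
  from wgrad_AE_eq[OF S this L2_diff[OF wgrad_properties(1)[OF H(1)] wgrad_properties(1)[OF H(2)]]
      is_weak_grad_diff[OF S L wgrad_properties(1)[OF H(1)] wgrad_properties(1)[OF H(2)]
        wgrad_properties(2)[OF H(1)] wgrad_properties(2)[OF H(2)]]]
  show "v - w \<in> H1 S" "AE x in lebesgue_on S. wgrad S (v - w) x = wgrad S v x - wgrad S w x" by auto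
qed

text \<open>The derivative of a product of two test functions integrates to zero, which is
  integration by parts for the classical gradient.\<close>

lemma wgrad_test_function:
  fixes \<phi> :: "real^'n \<Rightarrow> real^'n"
  assumes S: "open S" "bounded S" and \<phi>: "\<And>i. (\<lambda>x. \<phi> x $ i) \<in> test_functions S"
  shows "\<phi> \<in> H1 S"
    "AE x in lebesgue_on S. wgrad S \<phi> x = (\<chi> i j. pderiv_fun j (\<lambda>x. \<phi> x $ i) x)"
proof -
  let ?G = "\<lambda>x. \<chi> i j. pderiv_fun j (\<lambda>x. \<phi> x $ i) x"
  have "continuous_on UNIV (\<lambda>x. \<chi> i. \<phi> x $ i)"
    by (intro continuous_on_vec_lambda test_function_continuous[OF \<phi>])
  then have L: "\<phi> \<in> L2 S" using S by (intro L2_continuous) auto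
  have G: "?G \<in> L2 S"
    using S by (intro L2_continuous continuous_on_vec_lambda test_function_continuous[OF test_function_pderiv[OF \<phi>]])
  have "is_weak_grad S \<phi> ?G"
    unfolding is_weak_grad_def
  proof (intro ballI allI)
    fix \<psi> i j assume \<psi>: "\<psi> \<in> test_functions S"
    have i: "integrable (lebesgue_on S) (\<lambda>x. \<phi> x $ i * pderiv_fun j \<psi> x)"
      using integrable_mult_test_function[OF L2_integrable_component[OF L S(2,1), of "axis i 1"]
          test_function_pderiv[OF \<psi>]] by (simp add: inner_axis)
    have i': "integrable (lebesgue_on S) (\<lambda>x. pderiv_fun j (\<lambda>x. \<phi> x $ i) x * \<psi> x)"
      using integrable_mult_test_function[OF L2_integrable_component[OF G S(2,1), of "axis i (axis j 1)"] \<psi>]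
      by (simp add: inner_axis)
    have "0 = (LINT x|lebesgue_on S. pderiv_fun j (\<lambda>x. \<phi> x $ i * \<psi> x) x)"
      using integral_pderiv_test_function[OF test_function_mult[OF \<phi> \<psi>]] S by simp
    also have "\<dots> = (LINT x|lebesgue_on S. \<phi> x $ i * pderiv_fun j \<psi> x + pderiv_fun j (\<lambda>x. \<phi> x $ i) x * \<psi> x)"
      by (simp only: pderiv_fun_mult[OF test_function_differentiable[OF \<phi>] test_function_differentiable[OF \<psi>]])
    also have "\<dots> = (LINT x|lebesgue_on S. \<phi> x $ i * pderiv_fun j \<psi> x) +
        (LINT x|lebesgue_on S. pderiv_fun j (\<lambda>x. \<phi> x $ i) x * \<psi> x)"
      by (rule Bochner_Integration.integral_add[OF i i'])
    finally show "(LINT x|lebesgue_on S. \<phi> x $ i * pderiv_fun j \<psi> x) =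
        - (LINT x|lebesgue_on S. ?G x $ i $ j * \<psi> x)" by simp
  qed
  from wgrad_AE_eq[OF S L G this] show "\<phi> \<in> H1 S" "AE x in lebesgue_on S. wgrad S \<phi> x = ?G x" by auto
qed

lemma inner_mat_1: "mat 1 \<bullet> (M :: real^'n^'n) = trace M"
proof -
  have "mat 1 \<bullet> M = (\<Sum>i\<in>UNIV. \<Sum>j\<in>UNIV. if j = i then M $ i $ j else 0)"
    unfolding inner_vec_def mat_def by (intro sum.cong) auto
  then show ?thesis by (simp add: trace_def)
qed

text \<open>The left side is the integral of the divergence of \<open>w\<close>. It vanishes on test
  functions and is bounded by the H1 norm, in which test functions approximate
  \<open>w\<close>.\<close>

lemma l2_inner_identity_wgrad_H10:
  assumes S: "open S" "bounded S" and w: "w \<in> H10 S"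
  shows "l2_inner S (\<lambda>x. mat 1) (wgrad S w) = 0"
proof -
  let ?I = "\<lambda>x::real^'n. mat 1 :: real^'n^'n"
  have wH: "w \<in> H1 S" using w by (simp add: H10_def)
  obtain \<phi> where \<phi>: "\<And>k i. (\<lambda>x. \<phi> k x $ i) \<in> test_functions S"
    and lim: "(\<lambda>k::nat. H1_norm S (w - \<phi> k)) \<longlonglongrightarrow> 0"
    using w by (auto simp: H10_def)
  note LI = L2_const[OF S(2,1), of "mat 1 :: real^'n^'n"]
  \<comment> \<open>Subtracting \<open>\<phi> k\<close> does not change the integral, so
    Cauchy-Schwarz bounds it by a quantity that tends to 0.\<close>
  have bound: "\<bar>l2_inner S ?I (wgrad S w)\<bar> \<le> sqrt (l2_inner S ?I ?I) * H1_norm S (w - \<phi> k)" for k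
  proof -
    note p = wgrad_test_function[OF S \<phi>[of k]]
    note d = wgrad_diff[OF S wH p(1)]
    let ?G = "\<lambda>x. \<chi> i j. pderiv_fun j (\<lambda>x. \<phi> k x $ i) x"
    have G: "?G \<in> L2 S"
      using S by (intro L2_continuous continuous_on_vec_lambda test_function_continuous[OF test_function_pderiv[OF \<phi>]])
    have "l2_inner S ?I (wgrad S (\<phi> k)) = l2_inner S ?I ?G"
      by (rule l2_inner_cong_AE) (use LI G p wgrad_properties in auto)
    also have "\<dots> = (LINT x|lebesgue_on S. (\<Sum>i\<in>UNIV. pderiv_fun i (\<lambda>x. \<phi> k x $ i) x))"
      by (simp add: l2_inner_def inner_mat_1 trace_def)
    also have "\<dots> = (\<Sum>i\<in>UNIV. LINT x|lebesgue_on S. pderiv_fun i (\<lambda>x. \<phi> k x $ i) x)"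
      using L2_integrable_component[OF G S(2,1), of "axis i (axis i 1)" for i]
      by (intro Bochner_Integration.integral_sum) (simp add: inner_axis)
    also have "\<dots> = 0" using integral_pderiv_test_function[OF \<phi>] S by simp
    finally have z: "l2_inner S ?I (wgrad S (\<phi> k)) = 0" .
    have "l2_inner S ?I (wgrad S (w - \<phi> k)) = l2_inner S ?I (\<lambda>x. wgrad S w x - wgrad S (\<phi> k) x)"
      by (rule l2_inner_cong_AE) (auto intro!: L2_diff LI wgrad_properties(1) d wH p(1))
    also have "\<dots> = l2_inner S ?I (wgrad S w)"
      using z wH p by (subst l2_inner_diff_right) (auto intro: LI wgrad_properties)
    finally have e: "l2_inner S ?I (wgrad S w) = l2_inner S ?I (wgrad S (w - \<phi> k))" by simp
    have "\<bar>l2_inner S ?I (wgrad S w)\<bar> \<le> sqrt (l2_inner S ?I ?I * l2_inner S (wgrad S (w - \<phi> k)) (wgrad S (w - \<phi> k)))"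
      unfolding e by (intro real_le_rsqrt) (simp add: l2_inner_Cauchy_Schwarz[OF LI wgrad_properties(1)[OF d(1)]])
    also have "\<dots> \<le> sqrt (l2_inner S ?I ?I) * H1_norm S (w - \<phi> k)"
      unfolding real_sqrt_mult H1_norm_def
      by (intro mult_left_mono real_sqrt_le_mono) (auto simp: l2_inner_self_nonneg)
    finally show ?thesis .
  qed
  have "(\<lambda>k. sqrt (l2_inner S ?I ?I) * H1_norm S (w - \<phi> k)) \<longlonglongrightarrow> sqrt (l2_inner S ?I ?I) * 0"
    by (intro tendsto_mult_left lim)
  then have "\<bar>l2_inner S ?I (wgrad S w)\<bar> \<le> 0"
    using bound by (intro LIMSEQ_le_const) auto
  then show ?thesis by simp
qed

text \<open>A test function on \<open>S\<close> is also one on \<open>T\<close>, and the integrands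
  vanish outside \<open>S\<close>; so the gradient chosen on \<open>T\<close> is a weak gradient on
  \<open>S\<close>.\<close>

lemma wgrad_restrict:
  assumes T: "open T" "bounded T" and S: "open S" "S \<subseteq> T" and w: "w \<in> H1 T"
  shows "w \<in> H1 S" "AE x in lebesgue_on S. wgrad S w x = wgrad T w x"
proof -
  have Sb: "bounded S" using T S bounded_subset by blast
  have L: "w \<in> L2 S" "wgrad T w \<in> L2 S"
    using w wgrad_properties[OF w] T S by (auto simp: H1_def intro: L2_subset)
  have "is_weak_grad S w (wgrad T w)"
    unfolding is_weak_grad_def
  proof (intro ballI allI)
    fix \<phi> i j assume \<phi>: "\<phi> \<in> test_functions S"
    then have \<phi>T: "\<phi> \<in> test_functions T" using test_functions_mono[OF S(2)] by blast
    have "(LINT x|lebesgue_on T. w x $ i * pderiv_fun j \<phi> x) = (LINT x|lebesgue_on S. w x $ i * pderiv_fun j \<phi> x)"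
      using S T test_function_outside[OF test_function_pderiv[OF \<phi>]] by (intro integral_lebesgue_on_subset) auto
    moreover have "(LINT x|lebesgue_on T. wgrad T w x $ i $ j * \<phi> x) = (LINT x|lebesgue_on S. wgrad T w x $ i $ j * \<phi> x)"
      using S T test_function_outside[OF \<phi>] by (intro integral_lebesgue_on_subset) auto
    ultimately show "(LINT x|lebesgue_on S. w x $ i * pderiv_fun j \<phi> x) =
        - (LINT x|lebesgue_on S. wgrad T w x $ i $ j * \<phi> x)"
      using wgrad_properties(2)[OF w] \<phi>T by (simp add: is_weak_grad_def)
  qed
  from wgrad_AE_eq[OF S(1) Sb L this]
  show "w \<in> H1 S" "AE x in lebesgue_on S. wgrad S w x = wgrad T w x" by auto
qed

section \<open>Meshes\<close>

text \<open>Excludes slits: near a boundary point the set lies on one side of a Lipschitz graph, so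
  a point strictly above the graph has a neighbourhood free of \<open>S\<close> and is not in its
  closure.\<close>

lemma lipschitz_boundary_interior_closure:
  assumes "open S" "lipschitz_boundary S"
  shows "interior (closure S) = S"
proof
  show "S \<subseteq> interior (closure S)" using assms(1) by (simp add: closure_subset interior_maximal)
  show "interior (closure S) \<subseteq> S"
  proof (rule ccontr)
    assume "\<not> interior (closure S) \<subseteq> S"
    then obtain x where x: "x \<in> interior (closure S)" "x \<notin> S" by auto
    then have "x \<in> frontier S"
      using interior_subset interior_open[OF assms(1)] by (auto simp: frontier_def)
    then obtain e r L and g :: "real^'a \<Rightarrow> real" where e: "norm e = 1" and r: "0 < r"
      and g: "L-lipschitz_on {y. y \<bullet> e = 0} g"
      and sub: "\<And>y. y \<in> ball x r \<Longrightarrow> y \<in> S \<longleftrightarrow> y \<bullet> e < g (y - (y \<bullet> e) *\<^sub>R e)"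
      using assms(2) unfolding lipschitz_boundary_def by metis
    have ee: "e \<bullet> e = 1" using e by (simp add: norm_eq_1)
    obtain \<delta> where \<delta>: "0 < \<delta>" "ball x \<delta> \<subseteq> closure S"
      using x(1) by (auto simp: mem_interior)
    \<comment> \<open>Moving from \<open>x\<close> by \<open>t\<close> along \<open>e\<close> stays
      in both balls and arrives strictly above the graph, since \<open>x\<close> itself is not below
      it.\<close>
    define t where "t = min \<delta> r / 2"
    have t: "0 < t" "t < \<delta>" "t < r" using \<delta> r by (auto simp: t_def)
    define y where "y = x + t *\<^sub>R e"
    have "dist x y = t" using t e by (simp add: y_def dist_norm)
    then have y: "y \<in> closure S" "y \<in> ball x r" using \<delta> t by auto
    define U where "U = {z \<in> ball x r. g (z - (z \<bullet> e) *\<^sub>R e) < z \<bullet> e}"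
    have "continuous_on UNIV (\<lambda>z. g (z - (z \<bullet> e) *\<^sub>R e))"
      by (rule continuous_on_compose2[OF lipschitz_on_continuous_on[OF g]])
        (auto intro!: continuous_intros simp: inner_diff_left ee)
    then have "open {z. g (z - (z \<bullet> e) *\<^sub>R e) < z \<bullet> e}"
      by (intro open_Collect_less) (auto intro!: continuous_intros)
    then have "open U" unfolding U_def by (simp only: Collect_conj_eq Collect_mem_eq open_Int open_ball)
    moreover have "y \<in> U"
    proof -
      have "\<not> x \<bullet> e < g (x - (x \<bullet> e) *\<^sub>R e)" using sub[of x] x(2) r by simp
      moreover have "y - (y \<bullet> e) *\<^sub>R e = x - (x \<bullet> e) *\<^sub>R e"
        by (simp add: y_def inner_add_left ee algebra_simps)
      moreover have "y \<bullet> e = x \<bullet> e + t" by (simp add: y_def inner_add_left ee)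
      ultimately show ?thesis using y(2) t by (simp add: U_def)
    qed
    moreover have "U \<inter> S = {}" using sub by (auto simp: U_def)
    ultimately show False using y(1) by (metis IntI closure_iff_nhds_not_empty emptyE open_Int_closure_eq_empty)
  qed
qed

text \<open>A mesh only relates closures; that an open element lies in \<open>\<Omega>\<close>
  itself follows from \<open>interior (closure \<Omega>) = \<Omega>\<close>.\<close>

lemma mesh_element:
  assumes "mesh \<Omega> \<T>" "open \<Omega>" "bounded \<Omega>" "lipschitz_boundary \<Omega>" "K \<in> \<T>"
  shows "open K" "K \<subseteq> \<Omega>" "bounded K"
proof -
  show K: "open K" using assms by (auto simp: mesh_def)
  have "K \<subseteq> closure \<Omega>" using assms closure_subset unfolding mesh_def by blast
  then have "K \<subseteq> interior (closure \<Omega>)" using K by (simp add: interior_maximal)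
  then show "K \<subseteq> \<Omega>" using lipschitz_boundary_interior_closure assms by blast
  then show "bounded K" using assms bounded_subset by blast
qed

text \<open>What the elements miss lies on their boundaries, each covered by finitely many
  hyperplanes.\<close>

lemma mesh_null_complement:
  assumes "mesh \<Omega> \<T>"
  shows "negligible (\<Omega> - \<Union>\<T>)"
proof -
  have "negligible (frontier K)" if K: "K \<in> \<T>" for K
  proof -
    obtain H where H: "finite H" "\<And>h. h \<in> H \<Longrightarrow> \<exists>a b. a \<noteq> 0 \<and> h = {x. a \<bullet> x = b}" "frontier K \<subseteq> \<Union>H"
      using assms K unfolding mesh_def piecewise_planar_boundary_def by metis
    have "negligible h" if "h \<in> H" for h
      using H(2)[OF that] negligible_hyperplane by blast
    then have "negligible (\<Union>H)" using H(1) by (intro negligible_Union)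
    then show ?thesis using H(3) negligible_subset by blast
  qed
  then have "negligible (\<Union>(frontier ` \<T>))"
    using assms by (intro negligible_Union) (auto simp: mesh_def)
  moreover have "\<Omega> - \<Union>\<T> \<subseteq> \<Union>(frontier ` \<T>)"
  proof
    fix x assume x: "x \<in> \<Omega> - \<Union>\<T>"
    then have "x \<in> closure \<Omega>" using closure_subset by blast
    then obtain K where K: "K \<in> \<T>" "x \<in> closure K" using assms unfolding mesh_def by blast
    then have "x \<in> frontier K" using x assms interior_subset by (auto simp: frontier_def)
    then show "x \<in> \<Union>(frontier ` \<T>)" using K by blast
  qed
  ultimately show ?thesis by (rule negligible_subset)
qed

lemma mesh_sum_integral:
  fixes g :: "real^'n \<Rightarrow> real"
  assumes m: "mesh \<Omega> \<T>" and \<Omega>: "open \<Omega>" "bounded \<Omega>" "lipschitz_boundary \<Omega>"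
    and g: "integrable (lebesgue_on \<Omega>) g"
  shows "(\<Sum>K\<in>\<T>. LINT x|lebesgue_on K. g x) = (LINT x|lebesgue_on \<Omega>. g x)"
proof -
  note K = mesh_element[OF m \<Omega>]
  have gi: "set_integrable lebesgue \<Omega> g" using g \<Omega> by (simp add: set_integrable_def integrable_restrict_space)
  have "(LINT x|lebesgue_on \<Omega>. g x) = (LINT x:\<Omega>|lebesgue. g x)"
    using \<Omega> by (simp add: set_lebesgue_integral_def integral_restrict_space)
  also have "\<dots> = (LINT x:(\<Union>K\<in>\<T>. K)|lebesgue. g x)"
    unfolding set_lebesgue_integral_def
  proof (rule integral_cong_AE)
    have oU: "open (\<Union>K\<in>\<T>. K)" using K(1) by auto
    show "(\<lambda>x. indicat_real \<Omega> x *\<^sub>R g x) \<in> borel_measurable lebesgue"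
      using gi by (auto simp: set_integrable_def)
    have "set_integrable lebesgue (\<Union>K\<in>\<T>. K) g"
      by (rule set_integrable_subset[OF gi]) (use oU K(2) in auto)
    then show "(\<lambda>x. indicat_real (\<Union>K\<in>\<T>. K) x *\<^sub>R g x) \<in> borel_measurable lebesgue"
      by (auto simp: set_integrable_def)
    have "AE x in lebesgue. x \<notin> \<Omega> - \<Union>\<T>"
      using mesh_null_complement[OF m] AE_not_in by (simp only: negligible_iff_null_sets)
    then show "AE x in lebesgue. indicat_real \<Omega> x *\<^sub>R g x = indicat_real (\<Union>K\<in>\<T>. K) x *\<^sub>R g x"
      by eventually_elim (use K(2) in \<open>auto simp: indicator_def\<close>)
  qed
  also have "\<dots> = (\<Sum>K\<in>\<T>. LINT x:K|lebesgue. g x)"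
  proof (rule set_integral_finite_Union)
    show "finite \<T>" using m by (simp add: mesh_def)
    show "disjoint_family_on (\<lambda>K. K) \<T>"
      using m by (auto simp: mesh_def disjoint_family_on_def pairwise_def disjnt_def)
    show "set_integrable lebesgue K g" if "K \<in> \<T>" for K
      by (rule set_integrable_subset[OF gi]) (use K[OF that] in auto)
  qed (use K(1) in auto)
  also have "\<dots> = (\<Sum>K\<in>\<T>. LINT x|lebesgue_on K. g x)"
    using K(1) by (intro sum.cong) (auto simp: set_lebesgue_integral_def integral_restrict_space)
  finally show ?thesis by simp
qed

section \<open>The two formulations\<close>

text \<open>Measurability and bounds are given for the components \<open>A x E \<bullet> F\<close>,
  so \<open>A x (\<sigma> x)\<close> is expanded in the basis; the expansion is valid where
  \<open>A x\<close> is linear.\<close>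

lemma compliance_L2:
  assumes A: "compliance \<Omega> A" and \<Omega>: "open \<Omega>" and K: "open K" "K \<subseteq> \<Omega>" and \<sigma>: "\<sigma> \<in> L2 K"
  shows "(\<lambda>x. A x (\<sigma> x)) \<in> L2 K"
proof -
  note [measurable] = L2_measurable[OF \<sigma>]
  have "AE x in lebesgue_on \<Omega>. linear (A x)"
    using A unfolding compliance_def by (auto elim: eventually_mono)
  then have lin: "AE x in lebesgue_on K. linear (A x)"
    by (rule AE_lebesgue_on_subset) (use \<Omega> K in auto)
  have term_L2: "(\<lambda>x. ((\<sigma> x \<bullet> E) * (A x E \<bullet> F)) *\<^sub>R F) \<in> L2 K" if EF: "E \<in> Basis" "F \<in> Basis" for E F
  proof -
    have m: "(\<lambda>x. A x E \<bullet> F) \<in> borel_measurable (lebesgue_on \<Omega>)"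
      using A EF unfolding compliance_def by blast
    have [measurable]: "(\<lambda>x. A x E \<bullet> F) \<in> borel_measurable (lebesgue_on K)"
      by (rule measurable_restrict_mono[OF m K(2)])
    obtain C where "AE x in lebesgue_on \<Omega>. \<bar>A x E \<bullet> F\<bar> \<le> C"
      using A EF unfolding compliance_def by blast
    then have C: "AE x in lebesgue_on K. \<bar>A x E \<bullet> F\<bar> \<le> C"
      by (rule AE_lebesgue_on_subset) (use \<Omega> K in auto)
    show ?thesis
    proof (rule L2_bound[OF \<sigma>])
      show "AE x in lebesgue_on K. norm (((\<sigma> x \<bullet> E) * (A x E \<bullet> F)) *\<^sub>R F) \<le> C * norm (\<sigma> x)"
        using C
      proof eventually_elim
        case (elim x)
        have "\<bar>\<sigma> x \<bullet> E\<bar> \<le> norm (\<sigma> x)" using EF(1) by (rule Basis_le_norm)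
        with elim have "\<bar>A x E \<bullet> F\<bar> * \<bar>\<sigma> x \<bullet> E\<bar> \<le> C * norm (\<sigma> x)"
          by (intro mult_mono) auto
        then show ?case using EF(2) by (simp add: abs_mult mult.commute)
      qed
    qed measurable
  qed
  have "(\<lambda>x. \<Sum>E\<in>Basis. \<Sum>F\<in>Basis. ((\<sigma> x \<bullet> E) * (A x E \<bullet> F)) *\<^sub>R F) \<in> L2 K"
    by (intro L2_sum term_L2) auto
  moreover have "AE x in lebesgue_on K.
      (\<Sum>E\<in>Basis. \<Sum>F\<in>Basis. ((\<sigma> x \<bullet> E) * (A x E \<bullet> F)) *\<^sub>R F) = A x (\<sigma> x)"
    using lin
  proof eventually_elim
    case (elim x)
    have "A x (\<sigma> x) = A x (\<Sum>E\<in>Basis. (\<sigma> x \<bullet> E) *\<^sub>R E)" by (simp add: euclidean_representation)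
    also have "\<dots> = (\<Sum>E\<in>Basis. (\<sigma> x \<bullet> E) *\<^sub>R A x E)"
      using elim by (simp add: linear_sum linear_cmul)
    also have "\<dots> = (\<Sum>E\<in>Basis. (\<sigma> x \<bullet> E) *\<^sub>R (\<Sum>F\<in>Basis. (A x E \<bullet> F) *\<^sub>R F))"
      by (simp add: euclidean_representation)
    finally show ?case by (simp add: scaleR_sum_right)
  qed
  ultimately show ?thesis by (rule L2_cong_AE) (use K in auto)
qed

lemma l2_inner_zero: "l2_inner S 0 g = 0" "l2_inner S g 0 = 0"
  by (simp_all add: l2_inner_def)

text \<open>A constant matrix has zero divergence, so Green's formula leaves the gradient term:
  \<open>I n\<close> acts as the integral of the divergence of the lifting.\<close>

lemma normal_trace_identity:
  fixes w :: "real^'n \<Rightarrow> real^'n"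
  assumes "open K" "bounded K"
  shows "normal_trace K (\<lambda>x. c *\<^sub>R mat 1) w = c * l2_inner K (\<lambda>x. mat 1) (wgrad K w)"
  using l2_inner_AE_zero[OF wdiv_const(2)[OF assms], of "c *\<^sub>R mat 1" w]
  by (simp add: normal_trace_def) (simp add: l2_inner_def)

lemma normal_trace_zero:
  assumes "open K" "bounded K"
  shows "normal_trace K 0 w = 0" "normal_trace K \<tau> 0 = 0"
  using l2_inner_AE_zero[OF wdiv_const(2)[OF assms], of 0 w]
    l2_inner_AE_zero[OF wgrad_zero(2)[OF assms], of \<tau>]
  by (simp_all add: normal_trace_def zero_fun_def l2_inner_commute[of K \<tau>]) (simp_all add: l2_inner_def)

section \<open>The isotropic setting with constant \<open>Q\<close>\<close>

locale isotropic_mesh =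
  fixes \<Omega> :: "(real^'n) set" and \<T> :: "(real^'n) set set"
    and A :: "real^'n \<Rightarrow> real^'n^'n \<Rightarrow> real^'n^'n" and P Q :: "real^'n \<Rightarrow> real"
  assumes open_\<Omega>: "open \<Omega>" and bounded_\<Omega>: "bounded \<Omega>" and lipschitz_\<Omega>: "lipschitz_boundary \<Omega>"
    and mesh_\<T>: "mesh \<Omega> \<T>" and compliance_A: "compliance \<Omega> A" and isotropic_A: "isotropic \<Omega> A P Q"
    and Q_const: "\<forall>x\<in>\<Omega>. Q x = Q0 \<Omega> A"
begin

abbreviation "q0 \<equiv> Q0 \<Omega> A"

text \<open>By \<open>inner_mat_1\<close> this is the integral of the trace. It is summed over
  elements since broken test functions are controlled only there.\<close>

definition total_trace :: "(real^'n \<Rightarrow> real^'n^'n) \<Rightarrow> real"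
  where "total_trace \<tau> = l2_inner_broken \<T> (\<lambda>x. mat 1) \<tau>"

lemmas element = mesh_element[OF mesh_\<T> open_\<Omega> bounded_\<Omega> lipschitz_\<Omega>]

text \<open>For empty \<open>\<Omega>\<close> the value of \<open>Q0\<close> is the supremum of all reals, hence arbitrary.\<close>

lemma q0_nonzero_or_total_trace_zero: "q0 \<noteq> 0 \<or> total_trace \<tau> = 0"
proof (cases "\<Omega> = {}")
  case True
  then have "l2_inner K (\<lambda>x. mat 1) \<tau> = 0" if "K \<in> \<T>" for K
    using element(2)[OF that] by (simp add: l2_inner_def)
  then show ?thesis by (simp add: total_trace_def l2_inner_broken_def)
next
  case False
  then show ?thesis using isotropic_A Q_const by (auto simp: isotropic_def)
qed

text \<open>The deviatoric part has trace zero and does not see multiples of the identity, so only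
  the \<open>Q\<close> term contributes, and \<open>Q = q0\<close> on every element.\<close>

lemma AE_A_identity:
  assumes "K \<in> \<T>"
  shows "AE x in lebesgue_on K. (\<forall>\<tau>. mat 1 \<bullet> A x \<tau> = q0 * (mat 1 \<bullet> \<tau>)) \<and>
     (\<forall>\<tau> c. A x (\<tau> + c *\<^sub>R mat 1) = A x \<tau> + (c * q0) *\<^sub>R mat 1)"
proof -
  have I: "trace (mat 1 :: real^'n^'n) = real CARD('n)" by (simp add: trace_I)
  have add: "trace (a + b) = trace a + trace b" "trace (c *\<^sub>R a) = c * trace a" "trace (a - b) = trace a - trace b"
    for a b :: "real^'n^'n" and c
    by (simp_all add: trace_def sum.distrib sum_distrib_left sum_subtractf)
  have dev: "trace (deviatoric \<tau>) = 0" for \<tau> :: "real^'n^'n"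
    by (simp add: deviatoric_def add I)
  have dev_add: "deviatoric (\<tau> + c *\<^sub>R mat 1) = deviatoric \<tau>" for \<tau> :: "real^'n^'n" and c
    by (simp add: deviatoric_def add I add_divide_distrib scaleR_add_left)
  have "AE x in lebesgue_on \<Omega>. \<forall>\<tau>.
      A x \<tau> = P x *\<^sub>R deviatoric \<tau> + (Q x * (trace \<tau> / real CARD('n))) *\<^sub>R mat 1"
    using isotropic_A by (simp add: isotropic_def)
  then have "AE x in lebesgue_on K. \<forall>\<tau>.
      A x \<tau> = P x *\<^sub>R deviatoric \<tau> + (Q x * (trace \<tau> / real CARD('n))) *\<^sub>R mat 1"
    by (rule AE_lebesgue_on_subset) (use open_\<Omega> element[OF assms] in auto)
  moreover have "AE x in lebesgue_on K. Q x = q0"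
    using Q_const element[OF assms] by (intro AE_I2) auto
  ultimately show ?thesis
  proof eventually_elim
    case (elim x)
    have "mat 1 \<bullet> A x \<tau> = q0 * (mat 1 \<bullet> \<tau>)" for \<tau>
      by (simp add: elim inner_mat_1 add dev I)
    moreover have "A x (\<tau> + c *\<^sub>R mat 1) = A x \<tau> + (c * q0) *\<^sub>R mat 1" for \<tau> c
      by (simp add: elim dev_add add I add_divide_distrib algebra_simps)
    ultimately show ?case by blast
  qed
qed

lemma A_L2_element: "K \<in> \<T> \<Longrightarrow> \<sigma> \<in> L2 K \<Longrightarrow> (\<lambda>x. A x (\<sigma> x)) \<in> L2 K"
  using compliance_L2[OF compliance_A open_\<Omega>] element by blast

lemma const_L2_element: "K \<in> \<T> \<Longrightarrow> (\<lambda>x. c) \<in> L2 K"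
  by (rule L2_const) (use element in auto)

lemma l2_inner_identity_A:
  assumes "K \<in> \<T>" "\<tau> \<in> L2 K"
  shows "l2_inner K (\<lambda>x. c *\<^sub>R mat 1) (\<lambda>x. A x (\<tau> x)) = c * q0 * l2_inner K (\<lambda>x. mat 1) \<tau>"
proof -
  have "l2_inner K (\<lambda>x. c *\<^sub>R mat 1) (\<lambda>x. A x (\<tau> x)) = (LINT x|lebesgue_on K. c * q0 * (mat 1 \<bullet> \<tau> x))"
    unfolding l2_inner_def
  proof (rule integral_cong_AE)
    show "AE x in lebesgue_on K. c *\<^sub>R mat 1 \<bullet> A x (\<tau> x) = c * q0 * (mat 1 \<bullet> \<tau> x)"
      using AE_A_identity[OF assms(1)] by eventually_elim simp
    show "(\<lambda>x. c *\<^sub>R mat 1 \<bullet> A x (\<tau> x)) \<in> borel_measurable (lebesgue_on K)"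
      by (rule borel_measurable_integrable[OF L2_integrable_inner[OF const_L2_element A_L2_element]]) (use assms in auto)
    show "(\<lambda>x. c * q0 * (mat 1 \<bullet> \<tau> x)) \<in> borel_measurable (lebesgue_on K)"
      by (rule borel_measurable_integrable[OF integrable_mult_right[OF L2_integrable_inner[OF const_L2_element]]]) (use assms in auto)
  qed
  then show ?thesis by (simp add: l2_inner_def)
qed

lemma l2_inner_A_shift:
  assumes "K \<in> \<T>" "\<sigma> \<in> L2 K" "\<tau> \<in> L2 K"
  shows "l2_inner K (\<lambda>x. A x (\<sigma> x + c *\<^sub>R mat 1)) \<tau> =
    l2_inner K (\<lambda>x. A x (\<sigma> x)) \<tau> + c * q0 * l2_inner K (\<lambda>x. mat 1) \<tau>"
proof -
  have "l2_inner K (\<lambda>x. A x (\<sigma> x + c *\<^sub>R mat 1)) \<tau> =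
      l2_inner K (\<lambda>x. A x (\<sigma> x) + (c * q0) *\<^sub>R mat 1) \<tau>"
  proof (rule l2_inner_cong_AE)
    show "AE x in lebesgue_on K. A x (\<sigma> x + c *\<^sub>R mat 1) = A x (\<sigma> x) + (c * q0) *\<^sub>R mat 1"
      using AE_A_identity[OF assms(1)] by eventually_elim simp
  qed (use assms in \<open>auto intro!: A_L2_element L2_add const_L2_element\<close>)
  also have "\<dots> = l2_inner K (\<lambda>x. A x (\<sigma> x)) \<tau> + (c * q0) * l2_inner K (\<lambda>x. mat 1) \<tau>"
    by (rule l2_inner_add_scaleR_left) (use assms in \<open>auto intro!: A_L2_element const_L2_element\<close>)
  finally show ?thesis by simp
qed

lemma l2_inner_identity_skew:
  assumes "K \<in> \<T>" "q \<in> L2_skew \<Omega>"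
  shows "l2_inner K (\<lambda>x. mat 1) q = 0"
proof -
  have "AE x in lebesgue_on \<Omega>. transpose (q x) = - q x" using assms(2) by (simp add: L2_skew_def)
  then have "AE x in lebesgue_on K. transpose (q x) = - q x"
    by (rule AE_lebesgue_on_subset) (use open_\<Omega> element[OF assms(1)] in auto)
  then have "AE x in lebesgue_on K. mat 1 \<bullet> q x = 0"
  proof eventually_elim
    case (elim x)
    have "q x $ i $ i = - q x $ i $ i" for i
      using arg_cong[OF elim, of "\<lambda>M. M $ i $ i"] by (simp add: transpose_def)
    then show ?case by (simp add: inner_mat_1 trace_def)
  qed
  then show ?thesis unfolding l2_inner_def by (rule integral_eq_zero_AE)
qed

text \<open>The terms in \<open>v\<close> cancel by Green's formula, and \<open>q\<close> is trace free.\<close>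

lemma b_form_shift:
  assumes \<sigma>: "\<sigma> \<in> L2 \<Omega>" and V: "(\<tau>, v, q) \<in> V_space \<Omega> \<T>"
  shows "b_form \<T> A (\<sigma> + c *\<^sub>R (\<lambda>x. mat 1), u, uh, sn + c *\<^sub>R (\<lambda>K. normal_trace K (\<lambda>x. mat 1))) (\<tau>, v, q)
    = b_form \<T> A (\<sigma>, u, uh, sn) (\<tau>, v, q) + c * q0 * total_trace \<tau>"
proof -
  have \<tau>: "\<tau> \<in> L2 K" and v: "v \<in> H1 K" and q: "q \<in> L2_skew \<Omega>" and \<sigma>K: "\<sigma> \<in> L2 K" and qK: "q \<in> L2 K"
    if "K \<in> \<T>" for K
    using V that element[OF that] open_\<Omega> \<sigma>
    by (auto simp: V_space_def Hdiv_sym_broken_def Hdiv_def H1_broken_def L2_skew_def intro: L2_subset)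
  define s where "s = \<sigma> + c *\<^sub>R (\<lambda>x. mat 1 :: real^'n^'n)"
  define n where "n = sn + c *\<^sub>R (\<lambda>K. normal_trace K (\<lambda>x. mat 1 :: real^'n^'n))"
  have fe: "s = (\<lambda>x. \<sigma> x + c *\<^sub>R mat 1)"
    by (auto simp: s_def fun_eq_iff scaleR_fun_def)
  have 1: "l2_inner K (\<lambda>x. A x (s x)) \<tau> =
      l2_inner K (\<lambda>x. A x (\<sigma> x)) \<tau> + c * q0 * l2_inner K (\<lambda>x. mat 1) \<tau>" if "K \<in> \<T>" for K
    unfolding fe by (rule l2_inner_A_shift[OF that \<sigma>K[OF that] \<tau>[OF that]])
  have 2: "l2_inner K s (wgrad K v) =
      l2_inner K \<sigma> (wgrad K v) + c * l2_inner K (\<lambda>x. mat 1) (wgrad K v)" if "K \<in> \<T>" for K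
    unfolding fe by (rule l2_inner_add_scaleR_left[OF \<sigma>K[OF that] const_L2_element[OF that] wgrad_properties(1)[OF v[OF that]]])
  have 3: "n K v =
      sn K v + c * l2_inner K (\<lambda>x. mat 1) (wgrad K v)" if "K \<in> \<T>" for K
    using normal_trace_identity[OF element(1,3)[OF that], of 1 v] by (simp add: n_def scaleR_fun_def)
  have 4: "l2_inner K s q = l2_inner K \<sigma> q" if "K \<in> \<T>" for K
    unfolding fe using l2_inner_add_scaleR_left[OF \<sigma>K[OF that] const_L2_element[OF that] qK[OF that], of c "mat 1"]
      l2_inner_identity_skew[OF that q[OF that]] by simp
  show ?thesis
    unfolding s_def[symmetric] n_def[symmetric] b_form_def prod.case l2_inner_broken_def duality_skel_def total_trace_def
    by (simp add: 1 2 3 4 sum.distrib sum_distrib_left cong: sum.cong)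
qed

text \<open>Allows \<open>(I, 0, 0, I n)\<close> to be treated as a shift of the zero trial
  function. The value \<open>A x 0 = 0\<close> comes from linearity, which holds almost
  everywhere.\<close>

lemma b_form_zero_trial: "b_form \<T> A (0, 0, 0, 0) V = 0"
proof -
  obtain \<tau> v q where V: "V = (\<tau>, v, q)" by (cases V)
  have "l2_inner K (\<lambda>x. A x ((0::real^'n \<Rightarrow> real^'n^'n) x)) \<tau> = 0" if "K \<in> \<T>" for K
  proof (rule l2_inner_AE_zero)
    have "AE x in lebesgue_on \<Omega>. linear (A x)"
      using compliance_A unfolding compliance_def by (auto elim: eventually_mono)
    then have "AE x in lebesgue_on K. linear (A x)"
      by (rule AE_lebesgue_on_subset) (use open_\<Omega> element[OF that] in auto)
    then show "AE x in lebesgue_on K. A x ((0::real^'n \<Rightarrow> real^'n^'n) x) = 0"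
      by eventually_elim (simp add: linear_0)
  qed
  moreover have "normal_trace K \<tau> ((0::(real^'n) set \<Rightarrow> real^'n \<Rightarrow> real^'n) K) = 0" if "K \<in> \<T>" for K
    using normal_trace_zero(2)[OF element(1,3)[OF that]] by simp
  ultimately show ?thesis
    unfolding V b_form_def prod.case l2_inner_broken_def duality_skel_def by (simp add: l2_inner_zero)
qed

section \<open>Multiples of the identity as test functions\<close>

lemma V_space_identity: "((\<lambda>x. c *\<^sub>R mat 1), 0, 0) \<in> V_space \<Omega> \<T>"
proof -
  have "(\<lambda>x. c *\<^sub>R mat 1) \<in> Hdiv K" if "K \<in> \<T>" for K
    by (rule wdiv_const(1)[OF element(1,3)[OF that]])
  then have "(\<lambda>x. c *\<^sub>R mat 1) \<in> Hdiv_sym_broken \<T>"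
    by (auto simp: Hdiv_sym_broken_def transpose_scalar)
  moreover have "0 \<in> H1 K" if "K \<in> \<T>" for K
    by (rule wgrad_zero(1)[OF element(1,3)[OF that]])
  then have "0 \<in> H1_broken \<T>" by (simp add: H1_broken_def)
  moreover have "0 \<in> L2_skew \<Omega>" using L2_zero[of \<Omega>] by (auto simp: L2_skew_def zero_fun_def transpose_def vec_eq_iff)
  ultimately show ?thesis by (simp add: V_space_def)
qed

text \<open>The derivatives of constants vanish almost everywhere. Thus \<open>(c I, 0, 0)\<close>
  is the Riesz representative in \<open>V\<close> of \<open>c\<close> times the integrated
  trace.\<close>

lemma V_inner_identity:
  "V_inner \<Omega> \<T> ((\<lambda>x. c *\<^sub>R mat 1), 0, 0) (\<tau>, v, q) = c * total_trace \<tau>"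
proof -
  have "l2_inner K (\<lambda>x. c *\<^sub>R mat 1) \<tau> = c * l2_inner K (\<lambda>x. mat 1) \<tau>" for K
    by (simp add: l2_inner_def)
  moreover have "l2_inner K (wdiv K (\<lambda>x. c *\<^sub>R mat 1)) (wdiv K \<tau>) = 0" if "K \<in> \<T>" for K
    by (rule l2_inner_AE_zero[OF wdiv_const(2)[OF element(1,3)[OF that]]])
  moreover have "l2_inner K (wgrad K 0) (wgrad K v) = 0" if "K \<in> \<T>" for K
    by (rule l2_inner_AE_zero[OF wgrad_zero(2)[OF element(1,3)[OF that]]])
  ultimately show ?thesis
    unfolding V_inner_def prod.case l2_inner_broken_def total_trace_def
    by (simp add: sum_distrib_left l2_inner_zero)
qed

text \<open>Besides the trace of \<open>A \<sigma>\<close> only the flux of \<open>I n\<close>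
  against \<open>uh\<close> survives; the other terms contain a derivative of a constant or a zero
  component.\<close>

lemma b_form_identity_test:
  assumes \<sigma>: "\<sigma> \<in> L2 \<Omega>" and sn: "sn \<in> Hmhalf_skel \<Omega> \<T>"
  shows "b_form \<T> A (\<sigma>, u, uh, sn) ((\<lambda>x. c *\<^sub>R mat 1), 0, 0) =
    c * (q0 * total_trace \<sigma> - (\<Sum>K\<in>\<T>. l2_inner K (\<lambda>x. mat 1) (wgrad K (uh K))))"
proof -
  have "l2_inner K (\<lambda>x. A x (\<sigma> x)) (\<lambda>x. c *\<^sub>R mat 1) = c * (q0 * l2_inner K (\<lambda>x. mat 1) \<sigma>)" if "K \<in> \<T>" for K
    using l2_inner_identity_A[OF that L2_subset[OF \<sigma>], of c] element[OF that] open_\<Omega>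
    by (simp add: l2_inner_commute[of K "\<lambda>x. A x (\<sigma> x)"])
  moreover have "l2_inner K u (wdiv K (\<lambda>x. c *\<^sub>R mat 1)) = 0" if "K \<in> \<T>" for K
    unfolding l2_inner_commute[of K u] by (rule l2_inner_AE_zero[OF wdiv_const(2)[OF element(1,3)[OF that]]])
  moreover have "l2_inner K \<sigma> (wgrad K 0) = 0" if "K \<in> \<T>" for K
    unfolding l2_inner_commute[of K \<sigma>] by (rule l2_inner_AE_zero[OF wgrad_zero(2)[OF element(1,3)[OF that]]])
  moreover have "sn K 0 = 0" if "K \<in> \<T>" for K
  proof -
    have "sn K \<in> Hmhalf K" using sn that by (auto simp: Hmhalf_skel_def)
    \<comment> \<open>Linearity in \<open>Hmhalf\<close> is stated for combinations of two members
      of \<open>H1 K\<close>; the trivial one yields the value at 0.\<close>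
    then have "sn K (0 *\<^sub>R 0 + 0 *\<^sub>R 0) = 0 * sn K 0 + 0 * sn K 0"
      unfolding Hmhalf_def using wgrad_zero(1)[OF element(1,3)[OF that]] by blast
    then show ?thesis by simp
  qed
  ultimately show ?thesis
    unfolding b_form_def prod.case l2_inner_broken_def duality_skel_def total_trace_def
    by (simp add: normal_trace_identity[OF element(1,3)] sum_distrib_left right_diff_distrib
        l2_inner_zero)
qed

lemma b_form_zero_test:
  assumes "\<sigma> \<in> L2 \<Omega>" "sn \<in> Hmhalf_skel \<Omega> \<T>"
  shows "b_form \<T> A (\<sigma>, u, uh, sn) (0, 0, 0) = 0"
  using b_form_identity_test[OF assms, of u uh 0] by (simp add: zero_fun_def)

text \<open>The liftings \<open>uh K\<close> agree with one \<open>w\<close> in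
  \<open>H10 \<Omega>\<close> up to \<open>H10 K\<close>, which does not alter the element
  integrals. These add up to the integral of the divergence of \<open>w\<close> over
  \<open>\<Omega>\<close>.\<close>

lemma sum_normal_flux_zero:
  assumes "uh \<in> H0half_skel \<Omega> \<T>"
  shows "(\<Sum>K\<in>\<T>. l2_inner K (\<lambda>x. mat 1) (wgrad K (uh K))) = 0"
proof -
  obtain w where w: "w \<in> H10 \<Omega>" and tr: "\<And>K. K \<in> \<T> \<Longrightarrow> uh K - w \<in> H10 K"
    and uh: "\<And>K. K \<in> \<T> \<Longrightarrow> uh K \<in> H1 K"
    using assms by (auto simp: H0half_skel_def same_trace_def)
  have wH: "w \<in> H1 \<Omega>" using w by (simp add: H10_def)
  have wL: "wgrad \<Omega> w \<in> L2 \<Omega>" by (rule wgrad_properties[OF wH])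
  have "l2_inner K (\<lambda>x. mat 1) (wgrad K (uh K)) = l2_inner K (\<lambda>x. mat 1) (wgrad \<Omega> w)" if K: "K \<in> \<T>" for K
  proof -
    note e = element[OF K]
    note r = wgrad_restrict[OF open_\<Omega> bounded_\<Omega> e(1,2) wH]
    note d = wgrad_diff[OF e(1,3) uh[OF K] r(1)]
    have "0 = l2_inner K (\<lambda>x. mat 1) (wgrad K (uh K - w))"
      using l2_inner_identity_wgrad_H10[OF e(1,3) tr[OF K]] by simp
    also have "\<dots> = l2_inner K (\<lambda>x. mat 1) (\<lambda>x. wgrad K (uh K) x - wgrad K w x)"
      by (rule l2_inner_cong_AE) (auto intro!: const_L2_element K L2_diff wgrad_properties(1) d uh r(1))
    also have "\<dots> = l2_inner K (\<lambda>x. mat 1) (wgrad K (uh K)) - l2_inner K (\<lambda>x. mat 1) (wgrad K w)"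
      by (rule l2_inner_diff_right) (auto intro!: const_L2_element K wgrad_properties(1) uh r(1))
    also have "l2_inner K (\<lambda>x. mat 1) (wgrad K w) = l2_inner K (\<lambda>x. mat 1) (wgrad \<Omega> w)"
      by (rule l2_inner_cong_AE) (auto intro!: const_L2_element K wgrad_properties(1) r L2_subset[OF wL] e open_\<Omega>)
    finally show ?thesis by simp
  qed
  then have "(\<Sum>K\<in>\<T>. l2_inner K (\<lambda>x. mat 1) (wgrad K (uh K))) = (\<Sum>K\<in>\<T>. l2_inner K (\<lambda>x. mat 1) (wgrad \<Omega> w))"
    by simp
  also have "\<dots> = l2_inner \<Omega> (\<lambda>x. mat 1) (wgrad \<Omega> w)"
    unfolding l2_inner_def
    by (rule mesh_sum_integral[OF mesh_\<T> open_\<Omega> bounded_\<Omega> lipschitz_\<Omega>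
          L2_integrable_inner[OF L2_const[OF bounded_\<Omega> open_\<Omega>] wL]])
  also have "\<dots> = 0" by (rule l2_inner_identity_wgrad_H10[OF open_\<Omega> bounded_\<Omega> w])
  finally show ?thesis .
qed

text \<open>The trace identity for \<open>A\<close> produces the factor \<open>Q0\<close> that the
  scaling in \<open>b2_form\<close> cancels.\<close>

lemma b2_form_eq:
  assumes \<sigma>: "\<sigma> \<in> L2 \<Omega>" and \<tau>: "\<tau> \<in> Hdiv_sym_broken \<T>"
  shows "b2_form \<Omega> \<T> A (\<sigma>, u, uh, sn, \<alpha>) (\<tau>, v, q, \<beta>) =
    b_form \<T> A (\<sigma>, u, uh, sn) (\<tau>, v, q) + \<alpha> * total_trace \<tau> + \<beta> * total_trace \<sigma>"
proof -
  have \<tau>K: "\<tau> \<in> L2 K" and \<sigma>K: "\<sigma> \<in> L2 K" if "K \<in> \<T>" for K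
    using \<tau> \<sigma> that element[OF that] open_\<Omega> by (auto simp: Hdiv_sym_broken_def Hdiv_def intro: L2_subset)
  have 1: "l2_inner_broken \<T> (\<lambda>x. \<alpha> *\<^sub>R mat 1) (\<lambda>x. A x (\<tau> x)) = q0 * (\<alpha> * total_trace \<tau>)"
    by (simp add: l2_inner_broken_def total_trace_def l2_inner_identity_A \<tau>K sum_distrib_left algebra_simps)
  have 2: "l2_inner_broken \<T> (\<lambda>x. A x (\<sigma> x)) (\<lambda>x. \<beta> *\<^sub>R mat 1) = q0 * (\<beta> * total_trace \<sigma>)"
    by (simp add: l2_inner_broken_def total_trace_def l2_inner_identity_A \<sigma>K sum_distrib_left algebra_simps
        l2_inner_commute[of _ "\<lambda>x. A x (\<sigma> x)"])
  \<comment> \<open>If \<open>q0 = 0\<close>, possible only for empty \<open>\<Omega>\<close>, both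
    sides vanish with the total trace.\<close>
  have 3: "inverse q0 * (q0 * (c * total_trace g)) = c * total_trace g" for c g
    using q0_nonzero_or_total_trace_zero[of g] by auto
  show ?thesis unfolding b2_form_def prod.case 1 2 3 ..
qed

section \<open>Vanishing total trace of solutions\<close>

lemma total_trace_zero_if_solves:
  assumes sol: "solves_dpg \<Omega> \<T> A f (S \<times> W \<times> M \<times> F) (\<sigma>, u, uh, sn)"
    and S: "S \<subseteq> L2 \<Omega>" "(\<lambda>x. mat 1) \<in> S" and W: "0 \<in> W"
    and M: "M \<subseteq> H0half_skel \<Omega> \<T>" "0 \<in> M"
    and F: "F \<subseteq> Hmhalf_skel \<Omega> \<T>" "(\<lambda>K. normal_trace K (\<lambda>x. mat 1)) \<in> F"
  shows "total_trace \<sigma> = 0"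
proof -
  have U: "\<sigma> \<in> L2 \<Omega>" "uh \<in> H0half_skel \<Omega> \<T>" "sn \<in> Hmhalf_skel \<Omega> \<T>"
    using sol S M F by (auto simp: solves_dpg_def)
  let ?E = "((\<lambda>x. mat 1), 0, 0, (\<lambda>K. normal_trace K (\<lambda>x. mat 1))) :: 'n trial"
  \<comment> \<open>\<open>b_form\<close> at \<open>?E\<close>, a shift of zero with
    \<open>c = 1\<close>, and \<open>V_inner\<close> with \<open>q0 I\<close> both equal
    \<open>q0 * total_trace \<tau>\<close>.\<close>
  have "is_T \<Omega> \<T> A ?E ((\<lambda>x. q0 *\<^sub>R mat 1), 0, 0)"
    unfolding is_T_def
  proof (intro conjI ballI)
    fix \<W> :: "'n testf" assume "\<W> \<in> V_space \<Omega> \<T>"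
    moreover obtain \<tau> v q where W: "\<W> = (\<tau>, v, q)" by (cases \<W>)
    moreover have "0 \<in> L2 \<Omega>" using L2_zero[of \<Omega>] by (simp add: zero_fun_def)
    ultimately have "b_form \<T> A ?E \<W> = q0 * total_trace \<tau>"
      using b_form_shift[of 0 \<tau> v q 1 0 0 0] b_form_zero_trial by simp
    then show "V_inner \<Omega> \<T> ((\<lambda>x. q0 *\<^sub>R mat 1), 0, 0) \<W> = b_form \<T> A ?E \<W>"
      unfolding W V_inner_identity by simp
  qed (rule V_space_identity)
  moreover have "?E \<in> S \<times> W \<times> M \<times> F" using S W M F by simp
  ultimately have "((\<lambda>x. q0 *\<^sub>R mat 1), 0, 0) \<in> T_image \<Omega> \<T> A (S \<times> W \<times> M \<times> F)"
    unfolding T_image_def by blast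
  \<comment> \<open>The load is tested with \<open>v = 0\<close>, so the right side is zero.\<close>
  then have "b_form \<T> A (\<sigma>, u, uh, sn) ((\<lambda>x. q0 *\<^sub>R mat 1), 0, 0) = l2_inner \<Omega> f 0"
    using sol unfolding solves_dpg_def by blast
  then have "q0 * (q0 * total_trace \<sigma>) = 0"
    using b_form_identity_test[OF U(1,3)] sum_normal_flux_zero[OF U(2)] by (simp add: l2_inner_def)
  then show ?thesis using q0_nonzero_or_total_trace_zero by auto
qed

lemma total_trace_zero_if_solves2:
  assumes sol: "solves_dpg2 \<Omega> \<T> A f (extend_trial (S \<times> W \<times> M \<times> F)) (\<sigma>, u, uh, sn, 0)"
    and S: "S \<subseteq> L2 \<Omega>" "(\<lambda>x. mat 1) \<in> S" and W: "0 \<in> W" and M: "0 \<in> M"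
    and F: "F \<subseteq> Hmhalf_skel \<Omega> \<T>" "(\<lambda>K. normal_trace K (\<lambda>x. mat 1)) \<in> F"
  shows "total_trace \<sigma> = 0"
proof -
  have U: "\<sigma> \<in> L2 \<Omega>" "sn \<in> Hmhalf_skel \<Omega> \<T>"
    using sol S F by (auto simp: solves_dpg2_def extend_trial_def)
  let ?m = "total_trace (\<lambda>x. mat 1)"
  \<comment> \<open>The last entry \<open>- q0\<close> makes the \<alpha> term cancel
    \<open>b_form\<close> at the other entries, so only the last component of a test function is
    left.\<close>
  let ?E = "((\<lambda>x. mat 1), 0, 0, (\<lambda>K. normal_trace K (\<lambda>x. mat 1)), - q0) :: 'n trial2"
  have V0: "(0, 0, 0) \<in> V_space \<Omega> \<T>" using V_space_identity[of 0] by (simp add: zero_fun_def)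
  have "is_T2 \<Omega> \<T> A ?E (0, 0, 0, ?m)"
    unfolding is_T2_def
  proof (intro conjI ballI)
    show "(0, 0, 0, ?m) \<in> V2_space \<Omega> \<T>" using V0 by (auto simp: V_space_def V2_space_def)
    fix \<W> :: "'n testf2" assume "\<W> \<in> V2_space \<Omega> \<T>"
    moreover obtain \<tau> v q \<beta> where W: "\<W> = (\<tau>, v, q, \<beta>)" by (cases \<W>)
    ultimately have V: "(\<tau>, v, q) \<in> V_space \<Omega> \<T>" "\<tau> \<in> Hdiv_sym_broken \<T>"
      by (auto simp: V_space_def V2_space_def)
    have "0 \<in> L2 \<Omega>" using L2_zero[of \<Omega>] by (simp add: zero_fun_def)
    with V have "b_form \<T> A ((\<lambda>x. mat 1), 0, 0, (\<lambda>K. normal_trace K (\<lambda>x. mat 1))) (\<tau>, v, q) = q0 * total_trace \<tau>"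
      using b_form_shift[of 0 \<tau> v q 1 0 0 0] b_form_zero_trial by simp
    moreover have "(\<lambda>x. mat 1 :: real^'n^'n) \<in> L2 \<Omega>" by (rule subsetD[OF S])
    ultimately have "b2_form \<Omega> \<T> A ?E \<W> = \<beta> * ?m"
      unfolding W using b2_form_eq V by simp
    moreover have "V_inner \<Omega> \<T> (0, 0, 0) (\<tau>, v, q) = 0"
      using V_inner_identity[of 0 \<tau> v q] by (simp add: zero_fun_def)
    ultimately show "V2_inner \<Omega> \<T> (0, 0, 0, ?m) \<W> = b2_form \<Omega> \<T> A ?E \<W>"
      unfolding W V2_inner_def by simp
  qed
  moreover have "?E \<in> extend_trial (S \<times> W \<times> M \<times> F)" using S W M F by (simp add: extend_trial_def)
  ultimately have "(0, 0, 0, ?m) \<in> T2_image \<Omega> \<T> A (extend_trial (S \<times> W \<times> M \<times> F))"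
    unfolding T2_image_def by blast
  then have "b2_form \<Omega> \<T> A (\<sigma>, u, uh, sn, 0) (0, 0, 0, ?m) = l2_inner \<Omega> f 0"
    using sol unfolding solves_dpg2_def by blast
  moreover have "(0::real^'n \<Rightarrow> real^'n^'n) \<in> Hdiv_sym_broken \<T>" using V0 by (simp add: V_space_def)
  ultimately have "?m * total_trace \<sigma> = 0"
    using b2_form_eq[OF U(1)] b_form_zero_test[OF U] by (simp add: l2_inner_def)
  \<comment> \<open>\<open>?m\<close> is the sum of the squared norms of the identity on the
    elements. If it is zero, Cauchy-Schwarz on each element makes the trace of \<sigma> integrate to
    zero.\<close>
  moreover have "total_trace \<sigma> = 0" if m0: "?m = 0"
  proof -
    have "l2_inner K (\<lambda>x. mat 1) (\<lambda>x. mat 1 :: real^'n^'n) = 0" if "K \<in> \<T>" for K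
      using m0 that mesh_\<T> unfolding total_trace_def l2_inner_broken_def mesh_def
      by (subst (asm) sum_nonneg_eq_0_iff) (auto simp: l2_inner_self_nonneg)
    then have "l2_inner K (\<lambda>x. mat 1) \<sigma> = 0" if "K \<in> \<T>" for K
      using l2_inner_Cauchy_Schwarz[OF const_L2_element[OF that, of "mat 1"] L2_subset[OF U(1)]] element[OF that] open_\<Omega> that
      by simp
    then show ?thesis by (simp add: total_trace_def l2_inner_broken_def)
  qed
  ultimately show ?thesis by auto
qed

section \<open>Equivalence of the two methods\<close>

lemma solves_dpg_iff_solves_dpg2:
  assumes S: "subspace S" "S \<subseteq> L2 \<Omega>" "(\<lambda>x. mat 1) \<in> S" and W: "0 \<in> W"
    and M: "M \<subseteq> H0half_skel \<Omega> \<T>" "0 \<in> M"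
    and F: "subspace F" "F \<subseteq> Hmhalf_skel \<Omega> \<T>" "(\<lambda>K. normal_trace K (\<lambda>x. mat 1)) \<in> F"
  shows "solves_dpg \<Omega> \<T> A f (S \<times> W \<times> M \<times> F) (\<sigma>, u, uh, sn) \<longleftrightarrow>
    solves_dpg2 \<Omega> \<T> A f (extend_trial (S \<times> W \<times> M \<times> F)) (\<sigma>, u, uh, sn, 0)"
proof
  assume sol: "solves_dpg \<Omega> \<T> A f (S \<times> W \<times> M \<times> F) (\<sigma>, u, uh, sn)"
  note tr = total_trace_zero_if_solves[OF sol S(2,3) W M F(2,3)]
  have \<sigma>: "\<sigma> \<in> L2 \<Omega>" using sol S by (auto simp: solves_dpg_def)
  have "b2_form \<Omega> \<T> A (\<sigma>, u, uh, sn, 0) (\<tau>, v, q, \<beta>) = l2_inner \<Omega> f v"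
    if "(\<tau>, v, q, \<beta>) \<in> T2_image \<Omega> \<T> A (extend_trial (S \<times> W \<times> M \<times> F))" for \<tau> v q \<beta>
  proof -
    from that obtain \<U> where \<U>: "\<U> \<in> extend_trial (S \<times> W \<times> M \<times> F)"
      "is_T2 \<Omega> \<T> A \<U> (\<tau>, v, q, \<beta>)"
      unfolding T2_image_def by blast
    obtain \<sigma>' u' uh' sn' \<alpha> where \<U>_eq: "\<U> = (\<sigma>', u', uh', sn', \<alpha>)" by (cases \<U>)
    have U': "\<sigma>' \<in> S" "u' \<in> W" "uh' \<in> M" "sn' \<in> F"
      and T2: "is_T2 \<Omega> \<T> A (\<sigma>', u', uh', sn', \<alpha>) (\<tau>, v, q, \<beta>)"
      using \<U> by (auto simp: \<U>_eq extend_trial_def)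
    have V: "(\<tau>, v, q) \<in> V_space \<Omega> \<T>" using T2 by (auto simp: is_T2_def V2_space_def V_space_def)
    \<comment> \<open>Chosen so that \<open>c * q0 = \<alpha>\<close>: the shift then turns the
      \<alpha> term of \<open>b2_form\<close> into a part of \<open>b_form\<close>. For
      \<open>q0 = 0\<close> any value would do, as all total traces vanish.\<close>
    define c where "c = \<alpha> * inverse q0"
    have "is_T \<Omega> \<T> A (\<sigma>' + c *\<^sub>R (\<lambda>x. mat 1), u', uh', sn' + c *\<^sub>R (\<lambda>K. normal_trace K (\<lambda>x. mat 1))) (\<tau>, v, q)"
      unfolding is_T_def
    proof (intro conjI ballI V)
      fix \<W> :: "'n testf" assume "\<W> \<in> V_space \<Omega> \<T>"
      moreover obtain \<tau>' v' q' where W: "\<W> = (\<tau>', v', q')" by (cases \<W>)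
      ultimately have W': "(\<tau>', v', q') \<in> V_space \<Omega> \<T>" "\<tau>' \<in> Hdiv_sym_broken \<T>"
        "(\<tau>', v', q', 0) \<in> V2_space \<Omega> \<T>"
        by (auto simp: V_space_def V2_space_def)
      \<comment> \<open>Testing with last entry 0 removes \<beta> and the trace of
        \<open>\<sigma>'\<close>, leaving an identity for the \<open>V\<close> component.\<close>
      have "V_inner \<Omega> \<T> (\<tau>, v, q) (\<tau>', v', q') = V2_inner \<Omega> \<T> (\<tau>, v, q, \<beta>) (\<tau>', v', q', 0)"
        by (simp add: V2_inner_def)
      also have "\<dots> = b2_form \<Omega> \<T> A (\<sigma>', u', uh', sn', \<alpha>) (\<tau>', v', q', 0)"
        using T2 W'(3) by (simp add: is_T2_def)
      also have "\<dots> = b_form \<T> A (\<sigma>', u', uh', sn') (\<tau>', v', q') + \<alpha> * total_trace \<tau>'"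
        using U'(1) S(2) W'(2) by (subst b2_form_eq) auto
      also have "\<alpha> * total_trace \<tau>' = c * q0 * total_trace \<tau>'"
        using q0_nonzero_or_total_trace_zero[of \<tau>'] by (auto simp: c_def)
      also have "b_form \<T> A (\<sigma>', u', uh', sn') (\<tau>', v', q') + c * q0 * total_trace \<tau>' =
          b_form \<T> A (\<sigma>' + c *\<^sub>R (\<lambda>x. mat 1), u', uh', sn' + c *\<^sub>R (\<lambda>K. normal_trace K (\<lambda>x. mat 1))) (\<tau>', v', q')"
        using U'(1) S(2) W'(1) by (subst b_form_shift) auto
      finally show "V_inner \<Omega> \<T> (\<tau>, v, q) \<W> =
          b_form \<T> A (\<sigma>' + c *\<^sub>R (\<lambda>x. mat 1), u', uh', sn' + c *\<^sub>R (\<lambda>K. normal_trace K (\<lambda>x. mat 1))) \<W>"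
        unfolding W .
    qed
    \<comment> \<open>Here the discrete spaces must contain the identity and its normal
      trace.\<close>
    moreover have "\<sigma>' + c *\<^sub>R (\<lambda>x. mat 1) \<in> S" using S U' by (intro subspace_add subspace_scale)
    moreover have "sn' + c *\<^sub>R (\<lambda>K. normal_trace K (\<lambda>x. mat 1)) \<in> F"
      using F U' by (intro subspace_add subspace_scale)
    ultimately have "(\<tau>, v, q) \<in> T_image \<Omega> \<T> A (S \<times> W \<times> M \<times> F)"
      using U' unfolding T_image_def by blast
    then have "b_form \<T> A (\<sigma>, u, uh, sn) (\<tau>, v, q) = l2_inner \<Omega> f v"
      using sol unfolding solves_dpg_def by blast
    \<comment> \<open>With \<alpha> = 0 and zero total trace of \<sigma>, \<open>b2_form\<close>
      reduces to \<open>b_form\<close> whatever \<beta> is.\<close>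
    then show ?thesis using V \<sigma> tr by (subst b2_form_eq) (auto simp: V_space_def)
  qed
  moreover have "(\<sigma>, u, uh, sn, 0) \<in> extend_trial (S \<times> W \<times> M \<times> F)"
    using sol by (simp add: solves_dpg_def extend_trial_def)
  ultimately show "solves_dpg2 \<Omega> \<T> A f (extend_trial (S \<times> W \<times> M \<times> F)) (\<sigma>, u, uh, sn, 0)"
    unfolding solves_dpg2_def by blast
next
  assume sol: "solves_dpg2 \<Omega> \<T> A f (extend_trial (S \<times> W \<times> M \<times> F)) (\<sigma>, u, uh, sn, 0)"
  note tr = total_trace_zero_if_solves2[OF sol S(2,3) W M(2) F(2,3)]
  have U: "(\<sigma>, u, uh, sn) \<in> S \<times> W \<times> M \<times> F" using sol by (auto simp: solves_dpg2_def extend_trial_def)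
  then have \<sigma>: "\<sigma> \<in> L2 \<Omega>" using S by auto
  have "b_form \<T> A (\<sigma>, u, uh, sn) (\<tau>, v, q) = l2_inner \<Omega> f v"
    if "(\<tau>, v, q) \<in> T_image \<Omega> \<T> A (S \<times> W \<times> M \<times> F)" for \<tau> v q
  proof -
    from that obtain \<sigma>' u' uh' sn' where U': "(\<sigma>', u', uh', sn') \<in> S \<times> W \<times> M \<times> F"
      and T: "is_T \<Omega> \<T> A (\<sigma>', u', uh', sn') (\<tau>, v, q)"
      by (auto simp: T_image_def)
    have V: "(\<tau>, v, q) \<in> V_space \<Omega> \<T>" using T by (simp add: is_T_def)
    \<comment> \<open>With \<alpha> = 0 the \<open>V\<close> component is unchanged, and comparing
      the terms in \<open>\<beta>'\<close> dictates \<open>total_trace \<sigma>'\<close> as last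
      entry.\<close>
    have "is_T2 \<Omega> \<T> A (\<sigma>', u', uh', sn', 0) (\<tau>, v, q, total_trace \<sigma>')"
      unfolding is_T2_def
    proof (intro conjI ballI)
      show "(\<tau>, v, q, total_trace \<sigma>') \<in> V2_space \<Omega> \<T>" using V by (auto simp: V_space_def V2_space_def)
      fix \<W> :: "'n testf2" assume "\<W> \<in> V2_space \<Omega> \<T>"
      moreover obtain \<tau>' v' q' \<beta>' where W: "\<W> = (\<tau>', v', q', \<beta>')" by (cases \<W>)
      ultimately have W': "(\<tau>', v', q') \<in> V_space \<Omega> \<T>" "\<tau>' \<in> Hdiv_sym_broken \<T>"
        by (auto simp: V_space_def V2_space_def)
      then show "V2_inner \<Omega> \<T> (\<tau>, v, q, total_trace \<sigma>') \<W> = b2_form \<Omega> \<T> A (\<sigma>', u', uh', sn', 0) \<W>"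
        unfolding W using T U' S(2) by (subst b2_form_eq) (auto simp: V2_inner_def is_T_def)
    qed
    moreover have "(\<sigma>', u', uh', sn', 0) \<in> extend_trial (S \<times> W \<times> M \<times> F)"
      using U' by (simp add: extend_trial_def)
    ultimately have "(\<tau>, v, q, total_trace \<sigma>') \<in> T2_image \<Omega> \<T> A (extend_trial (S \<times> W \<times> M \<times> F))"
      unfolding T2_image_def by blast
    then have "b2_form \<Omega> \<T> A (\<sigma>, u, uh, sn, 0) (\<tau>, v, q, total_trace \<sigma>') = l2_inner \<Omega> f v"
      using sol unfolding solves_dpg2_def by blast
    then show ?thesis using V \<sigma> tr by (subst (asm) b2_form_eq) (auto simp: V_space_def)
  qed
  then show "solves_dpg \<Omega> \<T> A f (S \<times> W \<times> M \<times> F) (\<sigma>, u, uh, sn)"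
    unfolding solves_dpg_def using U by blast
qed

end

theorem theorem3:
  fixes \<Omega> :: "(real^'n) set" and \<T> :: "(real^'n) set set"
    and A :: "real^'n \<Rightarrow> real^'n^'n \<Rightarrow> real^'n^'n"
    and P Q :: "real^'n \<Rightarrow> real" and f :: "real^'n \<Rightarrow> real^'n"
    and Sigma_h :: "(real^'n \<Rightarrow> real^'n^'n) set" and W_h :: "(real^'n \<Rightarrow> real^'n) set"
    and M_h :: "((real^'n) set \<Rightarrow> real^'n \<Rightarrow> real^'n) set"
    and F_h :: "((real^'n) set \<Rightarrow> (real^'n \<Rightarrow> real^'n) \<Rightarrow> real) set"
  assumes "CARD('n) = 2 \<or> CARD('n) = 3"
    and "open \<Omega>" and "bounded \<Omega>" and "connected (frontier \<Omega>)" and "lipschitz_boundary \<Omega>"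
    and "mesh \<Omega> \<T>"
    and "compliance \<Omega> A"
    and "isotropic \<Omega> A P Q" and "\<forall>x\<in>\<Omega>. Q x = Q0 \<Omega> A"
    and "f \<in> L2 \<Omega>"
    and "quot_subspace (L2 \<Omega>) (ae_zero \<Omega>) Sigma_h"
    and "quot_subspace (L2 \<Omega>) (ae_zero \<Omega>) W_h"
    and "quot_subspace (H0half_skel \<Omega> \<T>) (H0half_skel_zero \<T>) M_h"
    and "quot_subspace (Hmhalf_skel \<Omega> \<T>) (Hmhalf_skel_zero \<T>) F_h"
    and "quot_finite_dim (trial_zero \<Omega> \<T>) (Sigma_h \<times> W_h \<times> M_h \<times> F_h)"
    and "(\<lambda>x. mat 1) \<in> Sigma_h"
    and "(\<lambda>K. normal_trace K (\<lambda>x. mat 1)) \<in> F_h"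
  shows "solves_dpg \<Omega> \<T> A f (Sigma_h \<times> W_h \<times> M_h \<times> F_h) (\<sigma>\<^sub>h, u\<^sub>h, uhat\<^sub>h, \<sigma>hat\<^sub>h) \<longleftrightarrow>
    solves_dpg2 \<Omega> \<T> A f (extend_trial (Sigma_h \<times> W_h \<times> M_h \<times> F_h)) (\<sigma>\<^sub>h, u\<^sub>h, uhat\<^sub>h, \<sigma>hat\<^sub>h, 0)"
proof -
  interpret isotropic_mesh \<Omega> \<T> A P Q
    by unfold_locales (use assms in auto)
  show ?thesis
    using assms by (intro solves_dpg_iff_solves_dpg2) (auto simp: quot_subspace_def subspace_0)
qed

end
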